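(* Let $\mathcal A$ be a weakly idempotent complete additive category, $\Omega$ the class of fibrantly weak factorization systems on $\mathcal A$, and $\Gamma$ the class of fibrant model structures on $\mathcal A$. For $(\mathrm{CoFib},\mathrm{TFib})\in\Omega$ put $$\mathcal C=\{X\mid (0\to X)\in\mathrm{CoFib}\},\quad \mathcal W=\{X\mid (X\to 0)\in\mathrm{TFib}\},\quad \mathrm{T}\mathcal C=\mathcal C\cap\mathcal W,$$ $$\mathrm{Fib}=\{\text{morphism } f\mid f\text{ is }\mathrm{Hom}_{\mathcal A}(\mathrm{T}\mathcal C,-)\text{-epic}\},\quad \mathrm{TCoFib}=\{\text{splitting monomorphism } f\mid \mathrm{Coker} f\in \mathrm{T}\mathcal C\},$$ $$\mathrm{Weq}=\mathrm{TFib}\circ\mathrm{TCoFib}=\{\,p i\mid i\in\mathrm{TCoFib},\ p\in\mathrm{TFib}\text{ composable}\,\}.$$ Then the map $$\Phi:\Omega\to\Gamma,\qquad (\mathrm{CoFib},\mathrm{TFib})\mapsto(\mathrm{CoFib},\mathrm{Fib},\mathrm{Weq}),$$ and the map $$\Psi:\Gamma\to\Omega,\qquad (\mathrm{CoFib},\mathrm{Fib},\mathrm{Weq})\mapsto(\mathrm{CoFib},\mathrm{TFib})\ \text{ with } \mathrm{TFib}=\mathrm{Fib}\cap\mathrm{Weq},$$ give a one-one correspondence between $\Omega$ and $\Gamma$ (that is, they are well defined and mutually inverse).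
   Context: An additive category is weakly idempotent complete if every splitting monomorphism (morphism with a left inverse) has a cokernel, or equivalently every splitting epimorphism (morphism with a right inverse) has a kernel. For morphisms $f:A\to B$, $g:C\to D$ write $f\,\square\, g$ if for all $u:A\to C$, $v:B\to D$ with $gu=vf$ there is $h:B\to C$ with $hf=u$ and $gh=v$. A morphism $g:A'\to B'$ is a retract of $f:A\to B$ if there are $\varphi_1:A'\to A$, $\psi_1:A\to A'$, $\varphi_2:B'\to B$, $\psi_2:B\to B'$ with $f\varphi_1=\varphi_2 g$, $g\psi_1=\psi_2 f$, $\psi_1\varphi_1=\mathrm{Id}_{A'}$, $\psi_2\varphi_2=\mathrm{Id}_{B'}$. A model structure on a category $\mathcal M$ (no existence of limits or colimits is required) is a triple $(\mathrm{CoFib},\mathrm{Fib},\mathrm{Weq})$ of classes of morphisms such that: (two out of three) for composable $f,g$, if two of $f,g,gf$ are in $\mathrm{Weq}$, so is the third; (retract) each of the three classes is closed under retracts; (lifting) if $f\in\mathrm{CoFib}$, $g\in\mathrm{Fib}$ and either $f\in\mathrm{Weq}$ or $g\in\mathrm{Weq}$, then $f\,\square\, g$; (factorization) every morphism $f$ admits factorizations $f=pi$ and $f=qj$ with $i\in\mathrm{CoFib}\cap\mathrm{Weq}$, $p\in\mathrm{Fib}$, $j\in\mathrm{CoFib}$, $q\in\mathrm{Fib}\cap\mathrm{Weq}$. On a category with zero object it is fibrant if every object $X$ is fibrant, i.e. $(X\to 0)\in\mathrm{Fib}$. A pair $(\mathrm L,\mathrm R)$ of classes of morphisms is a weak factorization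 system if: both $\mathrm L$ and $\mathrm R$ are closed under retracts; $l\,\square\, r$ for all $l\in\mathrm L$, $r\in\mathrm R$; every morphism $f$ factors as $f=rl$ with $l\in\mathrm L$, $r\in\mathrm R$. On a category with zero object, $(\mathrm L,\mathrm R)$ is a fibrantly weak factorization system if: (1) it is a weak factorization system; (2) for $f:A\to B$, $g:B\to C$, if $f,gf\in\mathrm R$ then $g\in\mathrm R$; (3) the class of objects $\mathcal L\cap\mathcal R$ is contravariantly finite, where $\mathcal L=\{X\mid (0\to X)\in\mathrm L\}$ and $\mathcal R=\{X\mid (X\to 0)\in\mathrm R\}$. A class $\mathcal U$ of objects is contravariantly finite in $\mathcal A$ if every object $B$ has a right $\mathcal U$-approximation, i.e. a morphism $t:U\to B$ with $U\in\mathcal U$ such that every morphism $U'\to B$ with $U'\in\mathcal U$ factors through $t$. A morphism $f$ is $\mathrm{Hom}_{\mathcal A}(\mathcal U,-)$-epic if $\mathrm{Hom}_{\mathcal A}(U,f)$ is surjective for every $U\in\mathcal U$. *)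

theory Defs
  imports "HOL-Algebra.Group"
begin

section \<open>Categories\<close>

text \<open>
  Classes of objects and of morphisms are sets over the two carrier types. Composition is written
  in the order of functions, and is only meaningful on composable pairs.
\<close>

record ('o, 'm) cat =
  Ob :: "'o set"
  Arr :: "'m set"
  Dom :: "'m \<Rightarrow> 'o"
  Cod :: "'m \<Rightarrow> 'o"
  Ident :: "'o \<Rightarrow> 'm"
  Comp :: "'m \<Rightarrow> 'm \<Rightarrow> 'm" (infixr "\<cdot>\<index>" 75)

definition Hom :: "('o, 'm, 'x) cat_scheme \<Rightarrow> 'o \<Rightarrow> 'o \<Rightarrow> 'm set" where
  "Hom C A B = {f \<in> Arr C. Dom C f = A \<and> Cod C f = B}"

locale category =
  fixes C :: "('o, 'm, 'x) cat_scheme" (structure)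
  assumes Dom_closed: "f \<in> Arr C \<Longrightarrow> Dom C f \<in> Ob C"
    and Cod_closed: "f \<in> Arr C \<Longrightarrow> Cod C f \<in> Ob C"
    and Ident_closed: "X \<in> Ob C \<Longrightarrow> Ident C X \<in> Hom C X X"
    and Comp_closed: "\<lbrakk>f \<in> Hom C X Y; g \<in> Hom C Y Z\<rbrakk> \<Longrightarrow> g \<cdot> f \<in> Hom C X Z"
    and Comp_assoc: "\<lbrakk>f \<in> Hom C W X; g \<in> Hom C X Y; h \<in> Hom C Y Z\<rbrakk>
      \<Longrightarrow> (h \<cdot> g) \<cdot> f = h \<cdot> (g \<cdot> f)"
    and Ident_left: "f \<in> Hom C X Y \<Longrightarrow> Ident C Y \<cdot> f = f"
    and Ident_right: "f \<in> Hom C X Y \<Longrightarrow> f \<cdot> Ident C X = f"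

definition is_zero_object :: "('o, 'm, 'x) cat_scheme \<Rightarrow> 'o \<Rightarrow> bool" where
  "is_zero_object C Z \<longleftrightarrow> Z \<in> Ob C \<and>
     (\<forall>X \<in> Ob C. (\<exists>!f. f \<in> Hom C Z X) \<and> (\<exists>!f. f \<in> Hom C X Z))"

text \<open>
  A zero object is chosen once and for all. All uses below concern classes of morphisms closed
  under retracts, hence under isomorphism, so the choice is immaterial.
\<close>

definition zero_object :: "('o, 'm, 'x) cat_scheme \<Rightarrow> 'o" where
  "zero_object C = (SOME Z. is_zero_object C Z)"

definition from_zero :: "('o, 'm, 'x) cat_scheme \<Rightarrow> 'o \<Rightarrow> 'm" where
  "from_zero C X = (THE f. f \<in> Hom C (zero_object C) X)"

definition to_zero :: "('o, 'm, 'x) cat_scheme \<Rightarrow> 'o \<Rightarrow> 'm" where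
  "to_zero C X = (THE f. f \<in> Hom C X (zero_object C))"

definition split_mono :: "('o, 'm, 'x) cat_scheme \<Rightarrow> 'm \<Rightarrow> bool" where
  "split_mono C f \<longleftrightarrow> f \<in> Arr C \<and>
     (\<exists>r \<in> Hom C (Cod C f) (Dom C f). r \<cdot>\<^bsub>C\<^esub> f = Ident C (Dom C f))"


section \<open>Additive categories\<close>

record ('o, 'm) acat = "('o, 'm) cat" +
  Add :: "'m \<Rightarrow> 'm \<Rightarrow> 'm" (infixl "\<oplus>\<index>" 65)
  Null :: "'o \<Rightarrow> 'o \<Rightarrow> 'm"

definition Hom_group :: "('o, 'm, 'x) acat_scheme \<Rightarrow> 'o \<Rightarrow> 'o \<Rightarrow> 'm monoid" where
  "Hom_group C A B = \<lparr>carrier = Hom C A B, mult = Add C, one = Null C A B\<rparr>"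

definition is_biproduct ::
    "('o, 'm, 'x) acat_scheme \<Rightarrow> 'o \<Rightarrow> 'o \<Rightarrow> 'o \<Rightarrow> 'm \<Rightarrow> 'm \<Rightarrow> 'm \<Rightarrow> 'm \<Rightarrow> bool" where
  "is_biproduct C X Y S i\<^sub>1 i\<^sub>2 p\<^sub>1 p\<^sub>2 \<longleftrightarrow>
     S \<in> Ob C \<and> i\<^sub>1 \<in> Hom C X S \<and> i\<^sub>2 \<in> Hom C Y S \<and> p\<^sub>1 \<in> Hom C S X \<and> p\<^sub>2 \<in> Hom C S Y \<and>
     p\<^sub>1 \<cdot>\<^bsub>C\<^esub> i\<^sub>1 = Ident C X \<and> p\<^sub>2 \<cdot>\<^bsub>C\<^esub> i\<^sub>2 = Ident C Y \<and>
     p\<^sub>1 \<cdot>\<^bsub>C\<^esub> i\<^sub>2 = Null C Y X \<and> p\<^sub>2 \<cdot>\<^bsub>C\<^esub> i\<^sub>1 = Null C X Y \<and>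
     (i\<^sub>1 \<cdot>\<^bsub>C\<^esub> p\<^sub>1) \<oplus>\<^bsub>C\<^esub> (i\<^sub>2 \<cdot>\<^bsub>C\<^esub> p\<^sub>2) = Ident C S"

locale additive_category = category C for C :: "('o, 'm, 'x) acat_scheme" (structure) +
  assumes Hom_comm_group: "\<lbrakk>X \<in> Ob C; Y \<in> Ob C\<rbrakk> \<Longrightarrow> comm_group (Hom_group C X Y)"
    and Comp_Add: "\<lbrakk>f \<in> Hom C X Y; f' \<in> Hom C X Y; g \<in> Hom C Y Z\<rbrakk>
      \<Longrightarrow> g \<cdot> (f \<oplus> f') = (g \<cdot> f) \<oplus> (g \<cdot> f')"
    and Add_Comp: "\<lbrakk>f \<in> Hom C X Y; g \<in> Hom C Y Z; g' \<in> Hom C Y Z\<rbrakk>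
      \<Longrightarrow> (g \<oplus> g') \<cdot> f = (g \<cdot> f) \<oplus> (g' \<cdot> f)"
    and zero_object_exists: "\<exists>Z. is_zero_object C Z"
    and biproduct_exists: "\<lbrakk>X \<in> Ob C; Y \<in> Ob C\<rbrakk>
      \<Longrightarrow> \<exists>S i\<^sub>1 i\<^sub>2 p\<^sub>1 p\<^sub>2. is_biproduct C X Y S i\<^sub>1 i\<^sub>2 p\<^sub>1 p\<^sub>2"

definition is_cokernel :: "('o, 'm, 'x) acat_scheme \<Rightarrow> 'm \<Rightarrow> 'm \<Rightarrow> bool" where
  "is_cokernel C f c \<longleftrightarrow>
     c \<in> Arr C \<and> Dom C c = Cod C f \<and> c \<cdot>\<^bsub>C\<^esub> f = Null C (Dom C f) (Cod C c) \<and>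
     (\<forall>Y \<in> Ob C. \<forall>g \<in> Hom C (Cod C f) Y. g \<cdot>\<^bsub>C\<^esub> f = Null C (Dom C f) Y \<longrightarrow>
        (\<exists>!h. h \<in> Hom C (Cod C c) Y \<and> h \<cdot>\<^bsub>C\<^esub> c = g))"

locale wic_additive_category = additive_category +
  assumes split_mono_cokernel: "split_mono C f \<Longrightarrow> \<exists>c. is_cokernel C f c"


section \<open>Weak factorization systems and model structures\<close>

definition lifts :: "('o, 'm, 'x) cat_scheme \<Rightarrow> 'm \<Rightarrow> 'm \<Rightarrow> bool" where
  "lifts C f g \<longleftrightarrow>
     (\<forall>u \<in> Hom C (Dom C f) (Dom C g). \<forall>v \<in> Hom C (Cod C f) (Cod C g).
        g \<cdot>\<^bsub>C\<^esub> u = v \<cdot>\<^bsub>C\<^esub> f \<longrightarrow>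
        (\<exists>h \<in> Hom C (Cod C f) (Dom C g). h \<cdot>\<^bsub>C\<^esub> f = u \<and> g \<cdot>\<^bsub>C\<^esub> h = v))"

definition retract_of :: "('o, 'm, 'x) cat_scheme \<Rightarrow> 'm \<Rightarrow> 'm \<Rightarrow> bool" where
  "retract_of C g f \<longleftrightarrow>
     (\<exists>\<phi>\<^sub>1 \<in> Hom C (Dom C g) (Dom C f). \<exists>\<psi>\<^sub>1 \<in> Hom C (Dom C f) (Dom C g).
      \<exists>\<phi>\<^sub>2 \<in> Hom C (Cod C g) (Cod C f). \<exists>\<psi>\<^sub>2 \<in> Hom C (Cod C f) (Cod C g).
        f \<cdot>\<^bsub>C\<^esub> \<phi>\<^sub>1 = \<phi>\<^sub>2 \<cdot>\<^bsub>C\<^esub> g \<and> g \<cdot>\<^bsub>C\<^esub> \<psi>\<^sub>1 = \<psi>\<^sub>2 \<cdot>\<^bsub>C\<^esub> f \<and>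
        \<psi>\<^sub>1 \<cdot>\<^bsub>C\<^esub> \<phi>\<^sub>1 = Ident C (Dom C g) \<and> \<psi>\<^sub>2 \<cdot>\<^bsub>C\<^esub> \<phi>\<^sub>2 = Ident C (Cod C g))"

definition retract_closed :: "('o, 'm, 'x) cat_scheme \<Rightarrow> 'm set \<Rightarrow> bool" where
  "retract_closed C K \<longleftrightarrow> (\<forall>f \<in> K. \<forall>g \<in> Arr C. retract_of C g f \<longrightarrow> g \<in> K)"

definition two_out_of_three :: "('o, 'm, 'x) cat_scheme \<Rightarrow> 'm set \<Rightarrow> bool" where
  "two_out_of_three C K \<longleftrightarrow>
     (\<forall>f \<in> Arr C. \<forall>g \<in> Arr C. Dom C g = Cod C f \<longrightarrow>
        (f \<in> K \<and> g \<in> K \<longrightarrow> g \<cdot>\<^bsub>C\<^esub> f \<in> K) \<and>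
        (f \<in> K \<and> g \<cdot>\<^bsub>C\<^esub> f \<in> K \<longrightarrow> g \<in> K) \<and>
        (g \<in> K \<and> g \<cdot>\<^bsub>C\<^esub> f \<in> K \<longrightarrow> f \<in> K))"

definition has_factorizations :: "('o, 'm, 'x) cat_scheme \<Rightarrow> 'm set \<Rightarrow> 'm set \<Rightarrow> bool" where
  "has_factorizations C L R \<longleftrightarrow>
     (\<forall>f \<in> Arr C. \<exists>l \<in> L. \<exists>r \<in> R. Dom C r = Cod C l \<and> f = r \<cdot>\<^bsub>C\<^esub> l)"

definition weak_factorization_system ::
    "('o, 'm, 'x) cat_scheme \<Rightarrow> 'm set \<Rightarrow> 'm set \<Rightarrow> bool" where
  "weak_factorization_system C L R \<longleftrightarrow>
     L \<subseteq> Arr C \<and> R \<subseteq> Arr C \<and>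
     retract_closed C L \<and> retract_closed C R \<and>
     (\<forall>l \<in> L. \<forall>r \<in> R. lifts C l r) \<and>
     has_factorizations C L R"

definition objects_from_zero_in :: "('o, 'm, 'x) cat_scheme \<Rightarrow> 'm set \<Rightarrow> 'o set" where
  "objects_from_zero_in C L = {X \<in> Ob C. from_zero C X \<in> L}"

definition objects_to_zero_in :: "('o, 'm, 'x) cat_scheme \<Rightarrow> 'm set \<Rightarrow> 'o set" where
  "objects_to_zero_in C R = {X \<in> Ob C. to_zero C X \<in> R}"

definition right_approximation :: "('o, 'm, 'x) cat_scheme \<Rightarrow> 'o set \<Rightarrow> 'o \<Rightarrow> 'm \<Rightarrow> bool" where
  "right_approximation C \<U> B t \<longleftrightarrow>
     (\<exists>U \<in> \<U>. t \<in> Hom C U B \<and>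
        (\<forall>U' \<in> \<U>. \<forall>s \<in> Hom C U' B. \<exists>h \<in> Hom C U' U. s = t \<cdot>\<^bsub>C\<^esub> h))"

definition contravariantly_finite :: "('o, 'm, 'x) cat_scheme \<Rightarrow> 'o set \<Rightarrow> bool" where
  "contravariantly_finite C \<U> \<longleftrightarrow>
     (\<forall>B \<in> Ob C. \<exists>t. right_approximation C \<U> B t)"

definition Hom_epic :: "('o, 'm, 'x) cat_scheme \<Rightarrow> 'o set \<Rightarrow> 'm \<Rightarrow> bool" where
  "Hom_epic C \<U> f \<longleftrightarrow> f \<in> Arr C \<and>
     (\<forall>U \<in> \<U>. (\<lambda>h. f \<cdot>\<^bsub>C\<^esub> h) ` Hom C U (Dom C f) = Hom C U (Cod C f))"

definition fibrantly_weak_factorization_system ::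
    "('o, 'm, 'x) cat_scheme \<Rightarrow> 'm set \<Rightarrow> 'm set \<Rightarrow> bool" where
  "fibrantly_weak_factorization_system C L R \<longleftrightarrow>
     weak_factorization_system C L R \<and>
     (\<forall>f \<in> Arr C. \<forall>g \<in> Arr C. Dom C g = Cod C f \<longrightarrow>
        f \<in> R \<and> g \<cdot>\<^bsub>C\<^esub> f \<in> R \<longrightarrow> g \<in> R) \<and>
     contravariantly_finite C (objects_from_zero_in C L \<inter> objects_to_zero_in C R)"

definition model_structure ::
    "('o, 'm, 'x) cat_scheme \<Rightarrow> 'm set \<Rightarrow> 'm set \<Rightarrow> 'm set \<Rightarrow> bool" where
  "model_structure C CoFib Fib Weq \<longleftrightarrow>
     CoFib \<subseteq> Arr C \<and> Fib \<subseteq> Arr C \<and> Weq \<subseteq> Arr C \<and>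
     two_out_of_three C Weq \<and>
     retract_closed C CoFib \<and> retract_closed C Fib \<and> retract_closed C Weq \<and>
     (\<forall>f \<in> CoFib. \<forall>g \<in> Fib. f \<in> Weq \<or> g \<in> Weq \<longrightarrow> lifts C f g) \<and>
     has_factorizations C (CoFib \<inter> Weq) Fib \<and>
     has_factorizations C CoFib (Fib \<inter> Weq)"

definition fibrant_model_structure ::
    "('o, 'm, 'x) cat_scheme \<Rightarrow> 'm set \<Rightarrow> 'm set \<Rightarrow> 'm set \<Rightarrow> bool" where
  "fibrant_model_structure C CoFib Fib Weq \<longleftrightarrow>
     model_structure C CoFib Fib Weq \<and> (\<forall>X \<in> Ob C. to_zero C X \<in> Fib)"


section \<open>The correspondence\<close>

definition Omega :: "('o, 'm, 'x) cat_scheme \<Rightarrow> ('m set \<times> 'm set) set" where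
  "Omega C = {(L, R). fibrantly_weak_factorization_system C L R}"

definition Gamma :: "('o, 'm, 'x) cat_scheme \<Rightarrow> ('m set \<times> 'm set \<times> 'm set) set" where
  "Gamma C = {(CoFib, Fib, Weq). fibrant_model_structure C CoFib Fib Weq}"

text \<open>
  Cokernels are determined only up to isomorphism: the cokernel of a morphism lies in a class of
  objects if some cokernel object of it does.
\<close>

definition split_monos_with_cokernel_in :: "('o, 'm, 'x) acat_scheme \<Rightarrow> 'o set \<Rightarrow> 'm set" where
  "split_monos_with_cokernel_in C \<U> =
     {f. split_mono C f \<and> (\<exists>c. is_cokernel C f c \<and> Cod C c \<in> \<U>)}"

definition composites :: "('o, 'm, 'x) cat_scheme \<Rightarrow> 'm set \<Rightarrow> 'm set \<Rightarrow> 'm set" where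
  "composites C P I = {p \<cdot>\<^bsub>C\<^esub> i | p i. p \<in> P \<and> i \<in> I \<and> Dom C p = Cod C i}"

definition Phi :: "('o, 'm, 'x) acat_scheme \<Rightarrow> 'm set \<times> 'm set \<Rightarrow> 'm set \<times> 'm set \<times> 'm set" where
  "Phi C = (\<lambda>(CoFib, TFib).
     let \<C> = objects_from_zero_in C CoFib;
         \<W> = objects_to_zero_in C TFib;
         T\<C> = \<C> \<inter> \<W>;
         Fib = {f. Hom_epic C T\<C> f};
         TCoFib = split_monos_with_cokernel_in C T\<C>;
         Weq = composites C TFib TCoFib
     in (CoFib, Fib, Weq))"

definition Psi :: "'m set \<times> 'm set \<times> 'm set \<Rightarrow> 'm set \<times> 'm set" where
  "Psi = (\<lambda>(CoFib, Fib, Weq). (CoFib, Fib \<inter> Weq))"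

end

theory Submission
  imports Defs
begin

text \<open>
  For a contravariantly finite class \<open>U\<close> of objects closed under retracts, the split monomorphisms
  with cokernel in \<open>U\<close> and the \<open>Hom(U, -)\<close>-epic morphisms form a weak factorization system
  \<open>(J, F)\<close>. A fibrantly weak factorization system \<open>(L, R)\<close> thus carries a second weak factorization
  system, and \<open>W = R \<circ> J\<close> is the class of weak equivalences. The key point is
  that membership of \<open>p \<cdot> i\<close> in \<open>W\<close>, for \<open>p\<close> in \<open>F\<close> and \<open>i\<close> in \<open>J\<close>, is equivalent to \<open>p\<close> being in \<open>R\<close>, whichever factorization is chosen; this reduces the
  closure properties of \<open>W\<close> to those of \<open>R\<close>. Conversely, in a fibrant model structure a trivial
  cofibration lifts against the map of its domain to zero and hence splits, so trivial cofibrations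
  and fibrations are the classes \<open>J\<close> and \<open>F\<close> of the class \<open>U\<close> of trivially cofibrant objects.
\<close>

section \<open>Lifting and weak factorization systems\<close>

context category
begin

lemma Hom_iff: "f \<in> Hom C X Y \<longleftrightarrow> f \<in> Arr C \<and> Dom C f = X \<and> Cod C f = Y"
  by (auto simp: Hom_def)

lemma Hom_objects: "f \<in> Hom C X Y \<Longrightarrow> X \<in> Ob C \<and> Y \<in> Ob C"
  using Dom_closed Cod_closed by (auto simp: Hom_iff)

lemma Comp_arr [simp]:
  assumes "f \<in> Arr C" "g \<in> Arr C" "Dom C g = Cod C f"
  shows "g \<cdot> f \<in> Arr C" "Dom C (g \<cdot> f) = Dom C f" "Cod C (g \<cdot> f) = Cod C g"
  using Comp_closed[of f "Dom C f" "Cod C f" g "Cod C g"] assms by (auto simp: Hom_iff)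

lemma Comp_assoc_arr [simp]:
  assumes "f \<in> Arr C" "g \<in> Arr C" "h \<in> Arr C" "Dom C g = Cod C f" "Dom C h = Cod C g"
  shows "(h \<cdot> g) \<cdot> f = h \<cdot> (g \<cdot> f)"
  using Comp_assoc[of f "Dom C f" "Cod C f" g "Cod C g" h "Cod C h"] assms by (auto simp: Hom_iff)

lemma Ident_arr [simp]:
  assumes "X \<in> Ob C"
  shows "Ident C X \<in> Arr C" "Dom C (Ident C X) = X" "Cod C (Ident C X) = X"
  using Ident_closed[OF assms] by (auto simp: Hom_iff)

lemma Ident_Comp [simp]:
  assumes "f \<in> Arr C" "Cod C f = X"
  shows "Ident C X \<cdot> f = f"
  using Ident_left[of f "Dom C f" X] assms by (auto simp: Hom_iff)

lemma Comp_Ident [simp]: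
  assumes "f \<in> Arr C" "Dom C f = X"
  shows "f \<cdot> Ident C X = f"
  using Ident_right[of f X "Cod C f"] assms by (auto simp: Hom_iff)

text \<open>Composites are normalized to the right, so an equation for \<open>g \<cdot> f\<close>
  does not match inside \<open>g \<cdot> (f \<cdot> x)\<close>. This form rewrites under a trailing
  factor.\<close>

lemma Comp_cong_left:
  assumes "g \<cdot> f = k" "x \<in> Arr C" "f \<in> Arr C" "g \<in> Arr C" "Dom C f = Cod C x" "Dom C g = Cod C f"
  shows "g \<cdot> (f \<cdot> x) = k \<cdot> x"
  using assms Comp_assoc_arr by metis

section \<open>Lifting problems, retracts and the retract argument\<close>

lemma liftsI:
  assumes "f \<in> Hom C A B" "g \<in> Hom C X Y"
    and "\<And>u v. \<lbrakk>u \<in> Hom C A X; v \<in> Hom C B Y; g \<cdot> u = v \<cdot> f\<rbrakk>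
      \<Longrightarrow> \<exists>h \<in> Hom C B X. h \<cdot> f = u \<and> g \<cdot> h = v"
  shows "lifts C f g"
  using assms by (auto simp: lifts_def Hom_iff)

lemma liftsE:
  assumes "lifts C f g" "f \<in> Hom C A B" "g \<in> Hom C X Y"
    "u \<in> Hom C A X" "v \<in> Hom C B Y" "g \<cdot> u = v \<cdot> f"
  obtains h where "h \<in> Hom C B X" "h \<cdot> f = u" "g \<cdot> h = v"
proof -
  have d: "Dom C f = A" "Cod C f = B" "Dom C g = X" "Cod C g = Y"
    using assms by (simp_all add: Hom_iff)
  show thesis
    using assms(1,4-6) that unfolding lifts_def d by blast
qed

lemma retract_ofI:
  assumes "g \<in> Hom C X' Y'" "f \<in> Hom C X Y"
    "\<phi>\<^sub>1 \<in> Hom C X' X" "\<psi>\<^sub>1 \<in> Hom C X X'" "\<phi>\<^sub>2 \<in> Hom C Y' Y" "\<psi>\<^sub>2 \<in> Hom C Y Y'"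
    "f \<cdot> \<phi>\<^sub>1 = \<phi>\<^sub>2 \<cdot> g" "g \<cdot> \<psi>\<^sub>1 = \<psi>\<^sub>2 \<cdot> f"
    "\<psi>\<^sub>1 \<cdot> \<phi>\<^sub>1 = Ident C X'" "\<psi>\<^sub>2 \<cdot> \<phi>\<^sub>2 = Ident C Y'"
  shows "retract_of C g f"
proof -
  have d: "Dom C f = X" "Cod C f = Y" "Dom C g = X'" "Cod C g = Y'"
    using assms by (simp_all add: Hom_iff)
  show ?thesis
    using assms(3-) unfolding retract_of_def d by blast
qed

lemma retract_of_refl: "f \<in> Arr C \<Longrightarrow> retract_of C f f"
  by (rule retract_ofI[of f "Dom C f" "Cod C f" f "Dom C f" "Cod C f" "Ident C (Dom C f)"
        "Ident C (Dom C f)" "Ident C (Cod C f)" "Ident C (Cod C f)"])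
     (auto simp: Hom_iff Dom_closed Cod_closed)

text \<open>The retract argument: lifting in the square with top \<open>l\<close> and identity
  bottom gives a section \<open>h\<close> of \<open>r\<close> compatible with the maps from the
  domain. Then \<open>h\<close> and \<open>r\<close> form the retraction on codomains.\<close>

lemma retract_of_left_factor:
  assumes "l \<in> Arr C" "r \<in> Arr C" "Dom C r = Cod C l" "lifts C (r \<cdot> l) r"
  shows "retract_of C (r \<cdot> l) l"
proof -
  let ?A = "Dom C l" and ?B = "Cod C r" and ?E = "Cod C l"
  have ob: "?A \<in> Ob C" "?B \<in> Ob C"
    using assms by (auto simp: Dom_closed Cod_closed)
  obtain h where h: "h \<in> Hom C ?B ?E" "h \<cdot> (r \<cdot> l) = l" "r \<cdot> h = Ident C ?B"
    by (rule liftsE[OF assms(4), of ?A ?B ?E ?B l "Ident C ?B"])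
       (use assms ob in \<open>auto simp: Hom_iff\<close>)
  show ?thesis
    by (rule retract_ofI[of _ ?A ?B _ ?A ?E "Ident C ?A" "Ident C ?A" h r])
       (use assms ob h in \<open>auto simp: Hom_iff\<close>)
qed

text \<open>Dual retract argument: the lift for the square with identity top and bottom
  \<open>r\<close> is a retraction of \<open>l\<close>, which acts on domains.\<close>

lemma retract_of_right_factor:
  assumes "l \<in> Arr C" "r \<in> Arr C" "Dom C r = Cod C l" "lifts C l (r \<cdot> l)"
  shows "retract_of C (r \<cdot> l) r"
proof -
  let ?A = "Dom C l" and ?B = "Cod C r" and ?E = "Cod C l"
  have ob: "?A \<in> Ob C" "?B \<in> Ob C"
    using assms by (auto simp: Dom_closed Cod_closed)
  obtain h where h: "h \<in> Hom C ?E ?A" "h \<cdot> l = Ident C ?A" "(r \<cdot> l) \<cdot> h = r"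
    by (rule liftsE[OF assms(4), of ?A ?E ?A ?B "Ident C ?A" r])
       (use assms ob in \<open>auto simp: Hom_iff\<close>)
  show ?thesis
    by (rule retract_ofI[of _ ?A ?B _ ?E ?B l h "Ident C ?B" "Ident C ?B"])
       (use assms ob h in \<open>auto simp: Hom_iff\<close>)
qed

text \<open>A square on \<open>g\<close> is pulled back along the retraction to a square on
  \<open>f\<close>; the lift found there is restricted along \<open>\<phi>\<^sub>2\<close>.\<close>

lemma lifts_retract_left:
  assumes "retract_of C g f" "lifts C f r" "g \<in> Arr C" "f \<in> Arr C" "r \<in> Arr C"
  shows "lifts C g r"
proof -
  let ?X' = "Dom C g" and ?Y' = "Cod C g" and ?X = "Dom C f" and ?Y = "Cod C f"
  obtain \<phi>\<^sub>1 \<psi>\<^sub>1 \<phi>\<^sub>2 \<psi>\<^sub>2 where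
    hom: "\<phi>\<^sub>1 \<in> Hom C ?X' ?X" "\<psi>\<^sub>1 \<in> Hom C ?X ?X'" "\<phi>\<^sub>2 \<in> Hom C ?Y' ?Y" "\<psi>\<^sub>2 \<in> Hom C ?Y ?Y'"
    and eq: "f \<cdot> \<phi>\<^sub>1 = \<phi>\<^sub>2 \<cdot> g" "g \<cdot> \<psi>\<^sub>1 = \<psi>\<^sub>2 \<cdot> f" "\<psi>\<^sub>1 \<cdot> \<phi>\<^sub>1 = Ident C ?X'" "\<psi>\<^sub>2 \<cdot> \<phi>\<^sub>2 = Ident C ?Y'"
    using assms(1) unfolding retract_of_def by blast
  note hom' = hom[unfolded Hom_iff]
  show ?thesis
  proof (rule liftsI[of g ?X' ?Y' r "Dom C r" "Cod C r"])
    fix u v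
    assume u: "u \<in> Hom C ?X' (Dom C r)" and v: "v \<in> Hom C ?Y' (Cod C r)" and sq: "r \<cdot> u = v \<cdot> g"
    note uv = u[unfolded Hom_iff] v[unfolded Hom_iff]
    have "r \<cdot> (u \<cdot> \<psi>\<^sub>1) = (r \<cdot> u) \<cdot> \<psi>\<^sub>1"
      using uv hom' assms by simp
    also have "\<dots> = (v \<cdot> \<psi>\<^sub>2) \<cdot> f"
      unfolding sq using uv hom' assms eq by simp
    finally obtain h where h: "h \<in> Hom C ?Y (Dom C r)" "h \<cdot> f = u \<cdot> \<psi>\<^sub>1" "r \<cdot> h = v \<cdot> \<psi>\<^sub>2"
      using liftsE[OF assms(2), of ?X ?Y "Dom C r" "Cod C r" "u \<cdot> \<psi>\<^sub>1" "v \<cdot> \<psi>\<^sub>2"] uv hom' assms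
      by (auto simp: Hom_iff)
    note h' = h(1)[unfolded Hom_iff]
    have "(h \<cdot> \<phi>\<^sub>2) \<cdot> g = (h \<cdot> f) \<cdot> \<phi>\<^sub>1"
      using h' hom' assms eq by simp
    also have "\<dots> = u"
      unfolding h(2) using uv hom' assms eq by simp
    finally have 1: "(h \<cdot> \<phi>\<^sub>2) \<cdot> g = u" .
    have "r \<cdot> (h \<cdot> \<phi>\<^sub>2) = (r \<cdot> h) \<cdot> \<phi>\<^sub>2"
      using h' hom' assms by simp
    also have "\<dots> = v"
      unfolding h(3) using uv hom' assms eq by simp
    finally show "\<exists>h \<in> Hom C ?Y' (Dom C r). h \<cdot> g = u \<and> r \<cdot> h = v"
      using 1 h' hom' by (intro bexI[of _ "h \<cdot> \<phi>\<^sub>2"]) (auto simp: Hom_iff)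
  qed (use assms in \<open>auto simp: Hom_iff\<close>)
qed

section \<open>Consequences of the axioms of a weak factorization system\<close>

context
  fixes L R
  assumes wfs: "weak_factorization_system C L R"
begin

lemma wfs_arr: "l \<in> L \<Longrightarrow> l \<in> Arr C" "r \<in> R \<Longrightarrow> r \<in> Arr C"
  using wfs by (auto simp: weak_factorization_system_def)

lemma wfs_lifts: "\<lbrakk>l \<in> L; r \<in> R\<rbrakk> \<Longrightarrow> lifts C l r"
  using wfs by (auto simp: weak_factorization_system_def)

lemma wfs_retract: "\<lbrakk>retract_of C g f; f \<in> L; g \<in> Arr C\<rbrakk> \<Longrightarrow> g \<in> L"
  "\<lbrakk>retract_of C g f; f \<in> R; g \<in> Arr C\<rbrakk> \<Longrightarrow> g \<in> R"
  using wfs by (auto simp: weak_factorization_system_def retract_closed_def)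

lemma wfs_factor:
  assumes "f \<in> Arr C"
  obtains l r where "l \<in> L" "r \<in> R" "Dom C r = Cod C l" "f = r \<cdot> l"
  using wfs assms by (auto simp: weak_factorization_system_def has_factorizations_def)

text \<open>By the retract argument, lifting against the right factor of \<open>f\<close> makes
  \<open>f\<close> a retract of its left factor. Each class thus determines the other, and
  membership becomes a lifting problem.\<close>

lemma wfs_left_iff: "f \<in> L \<longleftrightarrow> f \<in> Arr C \<and> (\<forall>r \<in> R. lifts C f r)"
proof
  assume f: "f \<in> Arr C \<and> (\<forall>r \<in> R. lifts C f r)"
  then obtain l r where "l \<in> L" "r \<in> R" "Dom C r = Cod C l" "f = r \<cdot> l"
    using wfs_factor by blast
  with f show "f \<in> L"
    using retract_of_left_factor wfs_retract wfs_arr by metis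
qed (use wfs_arr wfs_lifts in auto)

lemma wfs_right_iff: "f \<in> R \<longleftrightarrow> f \<in> Arr C \<and> (\<forall>l \<in> L. lifts C l f)"
proof
  assume f: "f \<in> Arr C \<and> (\<forall>l \<in> L. lifts C l f)"
  then obtain l r where "l \<in> L" "r \<in> R" "Dom C r = Cod C l" "f = r \<cdot> l"
    using wfs_factor by blast
  with f show "f \<in> R"
    using retract_of_right_factor wfs_retract wfs_arr by metis
qed (use wfs_arr wfs_lifts in auto)

text \<open>Lifts in two stages: first across \<open>f\<close>, then across \<open>g\<close> with
  the first lift as the new top edge.\<close>

lemma wfs_left_Comp:
  assumes "f \<in> L" "g \<in> L" "Dom C g = Cod C f"
  shows "g \<cdot> f \<in> L"
proof -
  note arr = wfs_arr(1)[OF assms(1)] wfs_arr(1)[OF assms(2)]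
  have "lifts C (g \<cdot> f) r" if r: "r \<in> R" for r
  proof (rule liftsI[of _ "Dom C f" "Cod C g" r "Dom C r" "Cod C r"])
    note r' = wfs_arr(2)[OF r]
    fix u v
    assume u: "u \<in> Hom C (Dom C f) (Dom C r)" and v: "v \<in> Hom C (Cod C g) (Cod C r)"
      and sq: "r \<cdot> u = v \<cdot> (g \<cdot> f)"
    note uv = u[unfolded Hom_iff] v[unfolded Hom_iff]
    obtain h where h: "h \<in> Hom C (Cod C f) (Dom C r)" "h \<cdot> f = u" "r \<cdot> h = v \<cdot> g"
      by (rule liftsE[OF wfs_lifts[OF assms(1) r], of "Dom C f" "Cod C f" "Dom C r" "Cod C r" u "v \<cdot> g"])
         (use uv arr assms(3) r' sq in \<open>auto simp: Hom_iff\<close>)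
    obtain k where k: "k \<in> Hom C (Cod C g) (Dom C r)" "k \<cdot> g = h" "r \<cdot> k = v"
      by (rule liftsE[OF wfs_lifts[OF assms(2) r], of "Dom C g" "Cod C g" "Dom C r" "Cod C r" h v])
         (use uv arr assms(3) r' h in \<open>auto simp: Hom_iff\<close>)
    have "k \<cdot> (g \<cdot> f) = h \<cdot> f"
      using Comp_cong_left[OF k(2), of f] k arr assms(3) by (auto simp: Hom_iff)
    with h k show "\<exists>k \<in> Hom C (Cod C g) (Dom C r). k \<cdot> (g \<cdot> f) = u \<and> r \<cdot> k = v"
      by auto
  qed (use arr assms(3) wfs_arr(2)[OF r] in \<open>auto simp: Hom_iff\<close>)
  then show ?thesis
    unfolding wfs_left_iff using arr assms(3) by simp
qed

lemma wfs_right_Comp: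
  assumes "f \<in> R" "g \<in> R" "Dom C g = Cod C f"
  shows "g \<cdot> f \<in> R"
proof -
  note arr = wfs_arr(2)[OF assms(1)] wfs_arr(2)[OF assms(2)]
  have "lifts C l (g \<cdot> f)" if l: "l \<in> L" for l
  proof (rule liftsI[of l "Dom C l" "Cod C l" _ "Dom C f" "Cod C g"])
    note l' = wfs_arr(1)[OF l]
    fix u v
    assume u: "u \<in> Hom C (Dom C l) (Dom C f)" and v: "v \<in> Hom C (Cod C l) (Cod C g)"
      and sq: "(g \<cdot> f) \<cdot> u = v \<cdot> l"
    note uv = u[unfolded Hom_iff] v[unfolded Hom_iff]
    obtain h where h: "h \<in> Hom C (Cod C l) (Dom C g)" "h \<cdot> l = f \<cdot> u" "g \<cdot> h = v"
      by (rule liftsE[OF wfs_lifts[OF l assms(2)], of "Dom C l" "Cod C l" "Dom C g" "Cod C g" "f \<cdot> u" v])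
         (use uv arr assms(3) l' sq in \<open>auto simp: Hom_iff\<close>)
    obtain k where k: "k \<in> Hom C (Cod C l) (Dom C f)" "k \<cdot> l = u" "f \<cdot> k = h"
      by (rule liftsE[OF wfs_lifts[OF l assms(1)], of "Dom C l" "Cod C l" "Dom C f" "Cod C f" u h])
         (use uv arr assms(3) l' h in \<open>auto simp: Hom_iff\<close>)
    have "(g \<cdot> f) \<cdot> k = g \<cdot> h"
      using k arr assms(3) by (auto simp: Hom_iff)
    with h k show "\<exists>k \<in> Hom C (Cod C l) (Dom C f). k \<cdot> l = u \<and> (g \<cdot> f) \<cdot> k = v"
      by auto
  qed (use arr assms(3) wfs_arr(1)[OF l] in \<open>auto simp: Hom_iff\<close>)
  then show ?thesis
    unfolding wfs_right_iff using arr assms(3) by simp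
qed

text \<open>The bottom edge of the square is itself the lift.\<close>

lemma wfs_right_Ident:
  assumes "X \<in> Ob C"
  shows "Ident C X \<in> R"
  unfolding wfs_right_iff
  using assms wfs_arr(1) by (auto simp: lifts_def Hom_iff)

end

end

section \<open>Zero objects and biproducts\<close>

context additive_category
begin

section \<open>Addition of morphisms and zero morphisms\<close>

lemma Add_arr [simp]:
  assumes "f \<in> Arr C" "g \<in> Arr C" "Dom C g = Dom C f" "Cod C g = Cod C f"
  shows "f \<oplus> g \<in> Arr C" "Dom C (f \<oplus> g) = Dom C f" "Cod C (f \<oplus> g) = Cod C f"
proof -
  interpret comm_group "Hom_group C (Dom C f) (Cod C f)"
    using assms by (simp add: Hom_comm_group Dom_closed Cod_closed)
  show "f \<oplus> g \<in> Arr C" "Dom C (f \<oplus> g) = Dom C f" "Cod C (f \<oplus> g) = Cod C f"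
    using m_closed[of f g] assms by (auto simp: Hom_group_def Hom_iff)
qed

lemma Null_arr [simp]:
  assumes "X \<in> Ob C" "Y \<in> Ob C"
  shows "Null C X Y \<in> Arr C" "Dom C (Null C X Y) = X" "Cod C (Null C X Y) = Y"
proof -
  interpret comm_group "Hom_group C X Y"
    using assms by (simp add: Hom_comm_group)
  show "Null C X Y \<in> Arr C" "Dom C (Null C X Y) = X" "Cod C (Null C X Y) = Y"
    using one_closed by (auto simp: Hom_group_def Hom_iff)
qed

lemma Add_Null [simp]:
  assumes "f \<in> Arr C" "Dom C f = X" "Cod C f = Y"
  shows "f \<oplus> Null C X Y = f" "Null C X Y \<oplus> f = f"
proof -
  interpret comm_group "Hom_group C X Y"
    using assms by (auto simp: Hom_comm_group Dom_closed Cod_closed)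
  show "f \<oplus> Null C X Y = f" "Null C X Y \<oplus> f = f"
    using l_one[of f] r_one[of f] assms by (auto simp: Hom_group_def Hom_iff)
qed

text \<open>The standard way below of showing that a composite vanishes without subtracting.\<close>

lemma Add_left_cancel:
  assumes "f \<in> Hom C X Y" "g \<in> Hom C X Y" "g \<oplus> f = g"
  shows "f = Null C X Y"
proof -
  interpret comm_group "Hom_group C X Y"
    using Hom_objects[OF assms(1)] by (simp add: Hom_comm_group)
  show ?thesis
    using l_cancel_one[of g f] assms by (auto simp: Hom_group_def)
qed

text \<open>The record has no negation, so the difference \<open>f\<close> minus \<open>g\<close> is
  introduced as a witness of an addition equation.\<close>

lemma difference_exists:
  assumes "f \<in> Hom C X Y" "g \<in> Hom C X Y"
  obtains d where "d \<in> Hom C X Y" "g \<oplus> d = f"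
proof -
  interpret G: comm_group "Hom_group C X Y"
    using Hom_objects[OF assms(1)] by (simp add: Hom_comm_group)
  let ?d = "inv\<^bsub>Hom_group C X Y\<^esub> g \<otimes>\<^bsub>Hom_group C X Y\<^esub> f"
  have c: "f \<in> carrier (Hom_group C X Y)" "g \<in> carrier (Hom_group C X Y)"
    using assms by (auto simp: Hom_group_def)
  then have "?d \<in> carrier (Hom_group C X Y)" "g \<otimes>\<^bsub>Hom_group C X Y\<^esub> ?d = f"
    by (auto simp: G.m_assoc[symmetric])
  then show ?thesis
    by (intro that[of ?d]) (auto simp: Hom_group_def)
qed

lemma Comp_Add_arr [simp]:
  assumes "f \<in> Arr C" "f' \<in> Arr C" "g \<in> Arr C" "Dom C f' = Dom C f" "Cod C f' = Cod C f"
    "Dom C g = Cod C f"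
  shows "g \<cdot> (f \<oplus> f') = (g \<cdot> f) \<oplus> (g \<cdot> f')"
  using Comp_Add[of f "Dom C f" "Cod C f" f' g "Cod C g"] assms by (auto simp: Hom_iff)

lemma Add_Comp_arr [simp]:
  assumes "f \<in> Arr C" "g \<in> Arr C" "g' \<in> Arr C" "Dom C g = Cod C f" "Dom C g' = Cod C f"
    "Cod C g' = Cod C g"
  shows "(g \<oplus> g') \<cdot> f = (g \<cdot> f) \<oplus> (g' \<cdot> f)"
  using Add_Comp[of f "Dom C f" "Cod C f" g "Cod C g" g'] assms by (auto simp: Hom_iff)

text \<open>Distributing over \<open>Null\<close> plus \<open>Null\<close> shows that the composite
  equals its own double.\<close>

lemma Comp_Null [simp]:
  assumes "g \<in> Arr C" "Dom C g = Y" "X \<in> Ob C"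
  shows "g \<cdot> Null C X Y = Null C X (Cod C g)"
proof -
  have Y: "Y \<in> Ob C" using assms Dom_closed by blast
  have "g \<cdot> (Null C X Y \<oplus> Null C X Y) = g \<cdot> Null C X Y \<oplus> g \<cdot> Null C X Y"
    using assms Y by (intro Comp_Add_arr) auto
  then show ?thesis
    using assms Y by (intro Add_left_cancel[of _ _ _ "g \<cdot> Null C X Y"]) (auto simp: Hom_iff)
qed

lemma Null_Comp [simp]:
  assumes "f \<in> Arr C" "Cod C f = Y" "Z \<in> Ob C"
  shows "Null C Y Z \<cdot> f = Null C (Dom C f) Z"
proof -
  have Y: "Y \<in> Ob C" using assms Cod_closed by blast
  have "(Null C Y Z \<oplus> Null C Y Z) \<cdot> f = Null C Y Z \<cdot> f \<oplus> Null C Y Z \<cdot> f"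
    using assms Y by (intro Add_Comp_arr) auto
  then show ?thesis
    using assms Y by (intro Add_left_cancel[of _ _ _ "Null C Y Z \<cdot> f"]) (auto simp: Hom_iff)
qed

section \<open>Lifting against morphisms from and to the zero object\<close>

lemma zero_object_zero: "is_zero_object C (zero_object C)"
  unfolding zero_object_def using zero_object_exists by (rule someI_ex)

lemma zero_object_Ob [simp]: "zero_object C \<in> Ob C"
  using zero_object_zero by (auto simp: is_zero_object_def)

lemma zero_object_initial: "X \<in> Ob C \<Longrightarrow> \<exists>!f. f \<in> Hom C (zero_object C) X"
  and zero_object_terminal: "X \<in> Ob C \<Longrightarrow> \<exists>!f. f \<in> Hom C X (zero_object C)"
  using zero_object_zero unfolding is_zero_object_def by fast+

lemma from_zero_unique:
  assumes "f \<in> Hom C (zero_object C) X" "g \<in> Hom C (zero_object C) X"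
  shows "f = g"
  using ex1E[OF zero_object_initial[of X], of "f = g"] assms Hom_objects[OF assms(1)] by metis

lemma to_zero_unique:
  assumes "f \<in> Hom C X (zero_object C)" "g \<in> Hom C X (zero_object C)"
  shows "f = g"
  using ex1E[OF zero_object_terminal[of X], of "f = g"] assms Hom_objects[OF assms(1)] by metis

lemma from_zero_Hom: "X \<in> Ob C \<Longrightarrow> from_zero C X \<in> Hom C (zero_object C) X"
  unfolding from_zero_def by (rule theI'[OF zero_object_initial])

lemma to_zero_Hom: "X \<in> Ob C \<Longrightarrow> to_zero C X \<in> Hom C X (zero_object C)"
  unfolding to_zero_def by (rule theI'[OF zero_object_terminal])

text \<open>Morphisms out of the zero object are unique, so every such square commutes and the upper
  triangle is automatic. Only lifting \<open>v\<close> through \<open>r\<close> remains.\<close>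

lemma lifts_from_zero_iff:
  assumes X: "X \<in> Ob C" and r: "r \<in> Arr C"
  shows "lifts C (from_zero C X) r \<longleftrightarrow>
    (\<forall>v \<in> Hom C X (Cod C r). \<exists>h \<in> Hom C X (Dom C r). r \<cdot> h = v)" (is "?l \<longleftrightarrow> ?r")
proof
  note z = from_zero_Hom[OF X] from_zero_Hom[of "Dom C r"]
  note z' = z[unfolded Hom_iff]
  {
    assume ?l
    show ?r
    proof
      fix v assume v: "v \<in> Hom C X (Cod C r)"
      have "r \<cdot> from_zero C (Dom C r) = v \<cdot> from_zero C X"
        by (rule from_zero_unique[of _ "Cod C r"])
           (use z' v r in \<open>auto simp: Hom_iff Dom_closed\<close>)
      then show "\<exists>h \<in> Hom C X (Dom C r). r \<cdot> h = v"
        using liftsE[OF \<open>?l\<close> z(1) _ z(2) v] r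
        by (metis Dom_closed Hom_iff)
    qed
  next
    assume r': ?r
    show ?l
    proof (rule liftsI[OF z(1), of r "Dom C r" "Cod C r"])
      fix u v
      assume u: "u \<in> Hom C (zero_object C) (Dom C r)" and v: "v \<in> Hom C X (Cod C r)"
      then obtain h where h: "h \<in> Hom C X (Dom C r)" "r \<cdot> h = v"
        using r' by blast
      have "h \<cdot> from_zero C X = u"
        using z' h u by (intro from_zero_unique[of _ "Dom C r"]) (auto simp: Hom_iff)
      with h show "\<exists>h \<in> Hom C X (Dom C r). h \<cdot> from_zero C X = u \<and> r \<cdot> h = v"
        by blast
    qed (use r in \<open>auto simp: Hom_iff\<close>)
  }
qed

lemma lifts_to_zero_iff:
  assumes X: "X \<in> Ob C" and l: "l \<in> Arr C"
  shows "lifts C l (to_zero C X) \<longleftrightarrow>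
    (\<forall>u \<in> Hom C (Dom C l) X. \<exists>h \<in> Hom C (Cod C l) X. h \<cdot> l = u)" (is "?l \<longleftrightarrow> ?r")
proof
  note z = to_zero_Hom[OF X] to_zero_Hom[of "Cod C l"]
  note z' = z[unfolded Hom_iff]
  {
    assume ?l
    show ?r
    proof
      fix u assume u: "u \<in> Hom C (Dom C l) X"
      have "to_zero C X \<cdot> u = to_zero C (Cod C l) \<cdot> l"
        by (rule to_zero_unique[of _ "Dom C l"])
           (use z' u l in \<open>auto simp: Hom_iff Cod_closed\<close>)
      then show "\<exists>h \<in> Hom C (Cod C l) X. h \<cdot> l = u"
        using liftsE[OF \<open>?l\<close> _ z(1) u z(2)] l
        by (metis Cod_closed Hom_iff)
    qed
  next
    assume r': ?r
    show ?l
    proof (rule liftsI[OF _ z(1), of l "Dom C l" "Cod C l"])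
      fix u v
      assume u: "u \<in> Hom C (Dom C l) X" and v: "v \<in> Hom C (Cod C l) (zero_object C)"
      then obtain h where h: "h \<in> Hom C (Cod C l) X" "h \<cdot> l = u"
        using r' by blast
      have "to_zero C X \<cdot> h = v"
        using z' h v by (intro to_zero_unique[of _ "Cod C l"]) (auto simp: Hom_iff)
      with h show "\<exists>h \<in> Hom C (Cod C l) X. h \<cdot> l = u \<and> to_zero C X \<cdot> h = v"
        by blast
    qed (use l in \<open>auto simp: Hom_iff\<close>)
  }
qed

text \<open>These are the objects projective relative to \<open>R\<close>; the chosen zero object
  disappears from the condition.\<close>

lemma objects_from_zero_iff:
  assumes "weak_factorization_system C L R"
  shows "X \<in> objects_from_zero_in C L \<longleftrightarrow> X \<in> Ob C \<and>
    (\<forall>r \<in> R. \<forall>v \<in> Hom C X (Cod C r). \<exists>h \<in> Hom C X (Dom C r). r \<cdot> h = v)"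
proof (cases "X \<in> Ob C")
  case True
  then have "from_zero C X \<in> L \<longleftrightarrow> (\<forall>r \<in> R. lifts C (from_zero C X) r)"
    unfolding wfs_left_iff[OF assms, of "from_zero C X"] using from_zero_Hom by (auto simp: Hom_iff)
  with True show ?thesis
    using lifts_from_zero_iff[OF True] wfs_arr(2)[OF assms]
    by (auto simp: objects_from_zero_in_def)
qed (auto simp: objects_from_zero_in_def)

text \<open>Dually, these are the objects injective relative to \<open>L\<close>.\<close>

lemma objects_to_zero_iff:
  assumes "weak_factorization_system C L R"
  shows "X \<in> objects_to_zero_in C R \<longleftrightarrow> X \<in> Ob C \<and>
    (\<forall>l \<in> L. \<forall>u \<in> Hom C (Dom C l) X. \<exists>h \<in> Hom C (Cod C l) X. h \<cdot> l = u)"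
proof (cases "X \<in> Ob C")
  case True
  then have "to_zero C X \<in> R \<longleftrightarrow> (\<forall>l \<in> L. lifts C l (to_zero C X))"
    unfolding wfs_right_iff[OF assms, of "to_zero C X"] using to_zero_Hom by (auto simp: Hom_iff)
  with True show ?thesis
    using lifts_to_zero_iff[OF True] wfs_arr(1)[OF assms]
    by (auto simp: objects_to_zero_in_def)
qed (auto simp: objects_to_zero_in_def)

section \<open>Biproducts, and split monomorphisms as biproduct inclusions\<close>

lemma biproduct_arr:
  assumes "is_biproduct C X Y S i k r c"
  shows "i \<in> Arr C" "Dom C i = X" "Cod C i = S" "k \<in> Arr C" "Dom C k = Y" "Cod C k = S"
    "r \<in> Arr C" "Dom C r = S" "Cod C r = X" "c \<in> Arr C" "Dom C c = S" "Cod C c = Y"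
    "X \<in> Ob C" "Y \<in> Ob C" "S \<in> Ob C"
  using assms Hom_objects[of i X S] Hom_objects[of k Y S]
  by (simp_all add: is_biproduct_def Hom_iff)

lemma biproduct_eq:
  assumes "is_biproduct C X Y S i k r c"
  shows "r \<cdot> i = Ident C X" "c \<cdot> k = Ident C Y" "r \<cdot> k = Null C Y X" "c \<cdot> i = Null C X Y"
    "(i \<cdot> r) \<oplus> (k \<cdot> c) = Ident C S"
  using assms by (simp_all add: is_biproduct_def)

lemma biproduct_Comp:
  assumes b: "is_biproduct C X Y S i k r c" and x: "x \<in> Arr C"
  shows "Cod C x = X \<Longrightarrow> r \<cdot> (i \<cdot> x) = x"
    "Cod C x = Y \<Longrightarrow> c \<cdot> (k \<cdot> x) = x"
    "Cod C x = Y \<Longrightarrow> r \<cdot> (k \<cdot> x) = Null C (Dom C x) X"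
    "Cod C x = X \<Longrightarrow> c \<cdot> (i \<cdot> x) = Null C (Dom C x) Y"
  using biproduct_arr[OF b] x
    Comp_cong_left[OF biproduct_eq(1)[OF b] x] Comp_cong_left[OF biproduct_eq(2)[OF b] x]
    Comp_cong_left[OF biproduct_eq(3)[OF b] x] Comp_cong_left[OF biproduct_eq(4)[OF b] x]
  by simp_all

lemma biproduct_decomp_left:
  assumes b: "is_biproduct C X Y S i k r c" and x: "x \<in> Arr C" "Cod C x = S"
  shows "(i \<cdot> (r \<cdot> x)) \<oplus> (k \<cdot> (c \<cdot> x)) = x"
proof -
  have "((i \<cdot> r) \<oplus> (k \<cdot> c)) \<cdot> x = (i \<cdot> (r \<cdot> x)) \<oplus> (k \<cdot> (c \<cdot> x))"
    using biproduct_arr[OF b] x by simp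
  then show ?thesis
    unfolding biproduct_eq(5)[OF b] using x by simp
qed

lemma biproduct_decomp_right:
  assumes b: "is_biproduct C X Y S i k r c" and x: "x \<in> Arr C" "Dom C x = S"
  shows "(x \<cdot> (i \<cdot> r)) \<oplus> (x \<cdot> (k \<cdot> c)) = x"
proof -
  have "x \<cdot> ((i \<cdot> r) \<oplus> (k \<cdot> c)) = (x \<cdot> (i \<cdot> r)) \<oplus> (x \<cdot> (k \<cdot> c))"
    using biproduct_arr[OF b] x by simp
  then show ?thesis
    unfolding biproduct_eq(5)[OF b] using x by simp
qed

text \<open>If \<open>g\<close> kills \<open>i\<close>, the decomposition of the identity leaves
  \<open>g = (g \<cdot> k) \<cdot> c\<close>. Uniqueness follows from \<open>c \<cdot> k\<close>
  being the identity.\<close>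

lemma biproduct_is_cokernel:
  assumes b: "is_biproduct C X Y S i k r c"
  shows "is_cokernel C i c"
proof -
  note [simp] = biproduct_arr[OF b] biproduct_eq[OF b] biproduct_Comp[OF b]
  have "\<exists>!h. h \<in> Hom C Y Z \<and> h \<cdot> c = g" if "g \<in> Hom C S Z" "g \<cdot> i = Null C X Z" for g Z
  proof -
    note g = that(1)[unfolded Hom_iff]
    have Z: "Z \<in> Ob C" using Hom_objects[OF that(1)] by simp
    have "g \<cdot> (i \<cdot> r) = Null C S Z"
      using Comp_cong_left[OF that(2), of r] g Z by simp
    with biproduct_decomp_right[OF b, of g] g Z have "(g \<cdot> k) \<cdot> c = g"
      by simp
    moreover have "h = g \<cdot> k" if "h \<in> Hom C Y Z" "h \<cdot> c = g" for h
    proof -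
      have "(h \<cdot> c) \<cdot> k = h" using that(1) by (simp add: Hom_iff)
      then show ?thesis using that(2) by simp
    qed
    ultimately show ?thesis
      using g by (intro ex1I[of _ "g \<cdot> k"]) (auto simp: Hom_iff)
  qed
  then show ?thesis
    by (auto simp: is_cokernel_def)
qed

text \<open>The difference of the identity and \<open>f \<cdot> r\<close> kills \<open>f\<close>, so
  it factors as \<open>k \<cdot> c\<close>. The remaining biproduct equations come from uniqueness
  of factorizations through the cokernel \<open>c\<close>.\<close>

lemma cokernel_biproduct:
  assumes f: "f \<in> Hom C X E" and r: "r \<in> Hom C E X" and rf: "r \<cdot> f = Ident C X"
    and c: "is_cokernel C f c"
  obtains k where "is_biproduct C X (Cod C c) E f k r c"
proof -
  let ?K = "Cod C c"
  note fr = f[unfolded Hom_iff] r[unfolded Hom_iff]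
  have c': "c \<in> Arr C" "Dom C c = E" "c \<cdot> f = Null C X ?K"
    and cu: "\<And>Y g. \<lbrakk>g \<in> Hom C E Y; g \<cdot> f = Null C X Y\<rbrakk> \<Longrightarrow> \<exists>!h. h \<in> Hom C ?K Y \<and> h \<cdot> c = g"
    using c Hom_objects fr unfolding is_cokernel_def by auto
  have ob: "X \<in> Ob C" "E \<in> Ob C" "?K \<in> Ob C"
    using Hom_objects[OF f] c' Cod_closed by auto
  note [simp] = fr c' ob rf
  obtain d where d: "d \<in> Hom C E E" "(f \<cdot> r) \<oplus> d = Ident C E"
    using difference_exists[of "Ident C E" E E "f \<cdot> r"] by (auto simp: Hom_iff)
  note [simp] = d(1)[unfolded Hom_iff]
  have "((f \<cdot> r) \<oplus> d) \<cdot> f = f \<oplus> (d \<cdot> f)" by simp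
  then have df: "d \<cdot> f = Null C X E"
    unfolding d(2) by (intro Add_left_cancel[of _ _ _ f]) (auto simp: Hom_iff)
  obtain k where k: "k \<in> Hom C ?K E" "k \<cdot> c = d"
    using cu[OF d(1) df] by blast
  note [simp] = k(1)[unfolded Hom_iff]
  have "c \<cdot> (f \<cdot> r) = Null C E ?K"
    using Comp_cong_left[OF c'(3), of r] by simp
  then have "c \<cdot> ((f \<cdot> r) \<oplus> d) = c \<cdot> d" by simp
  then have cd: "c \<cdot> d = c"
    unfolding d(2) by simp
  \<comment> \<open>Both \<open>c \<cdot> k\<close> and the identity factor \<open>c\<close> through
    \<open>c\<close>, so they agree.\<close>
  have "\<exists>!h. h \<in> Hom C ?K ?K \<and> h \<cdot> c = c"
    by (rule cu) (auto simp: Hom_iff)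
  moreover have "(c \<cdot> k) \<cdot> c = c" by (simp add: k(2) cd)
  moreover have "Ident C ?K \<cdot> c = c" by simp
  ultimately have ck: "c \<cdot> k = Ident C ?K"
    by (metis Comp_closed Hom_iff Ident_closed c'(1,2) k(1) ob(3))
  have "r \<cdot> (f \<cdot> r) = r"
    using Comp_cong_left[OF rf, of r] by simp
  then have "r \<cdot> ((f \<cdot> r) \<oplus> d) = r \<oplus> (r \<cdot> d)" by simp
  then have rd: "r \<cdot> d = Null C E X"
    unfolding d(2) by (intro Add_left_cancel[of _ _ _ r]) (auto simp: Hom_iff)
  \<comment> \<open>Likewise \<open>r \<cdot> k\<close> and the zero morphism both factor zero
    through \<open>c\<close>.\<close>
  have "\<exists>!h. h \<in> Hom C ?K X \<and> h \<cdot> c = Null C E X"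
    by (rule cu) (auto simp: Hom_iff)
  moreover have "(r \<cdot> k) \<cdot> c = Null C E X" by (simp add: k(2) rd)
  moreover have "Null C ?K X \<cdot> c = Null C E X" by simp
  moreover have "r \<cdot> k \<in> Hom C ?K X" "Null C ?K X \<in> Hom C ?K X" by (simp_all add: Hom_iff)
  ultimately have rk: "r \<cdot> k = Null C ?K X" by blast
  have "is_biproduct C X ?K E f k r c"
    using ck rk d(2) k(2) by (simp add: is_biproduct_def Hom_iff)
  then show ?thesis by (rule that)
qed

text \<open>Replaces the universal property of the cokernel by equations in biproduct data, which
  suit calculation better.\<close>

lemma split_monos_with_cokernel_in_iff:
  "f \<in> split_monos_with_cokernel_in C U \<longleftrightarrow>
    (\<exists>K \<in> U. \<exists>k r c. is_biproduct C (Dom C f) K (Cod C f) f k r c)"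
proof
  assume "f \<in> split_monos_with_cokernel_in C U"
  then obtain r c where f: "f \<in> Arr C" "r \<in> Hom C (Cod C f) (Dom C f)"
      "r \<cdot> f = Ident C (Dom C f)" "is_cokernel C f c" "Cod C c \<in> U"
    unfolding split_monos_with_cokernel_in_def split_mono_def by blast
  then obtain k where "is_biproduct C (Dom C f) (Cod C c) (Cod C f) f k r c"
    using cokernel_biproduct[of f "Dom C f" "Cod C f" r c] by (auto simp: Hom_iff)
  with f(5) show "\<exists>K \<in> U. \<exists>k r c. is_biproduct C (Dom C f) K (Cod C f) f k r c" by blast
next
  assume "\<exists>K \<in> U. \<exists>k r c. is_biproduct C (Dom C f) K (Cod C f) f k r c"
  then obtain K k r c where K: "K \<in> U" and b: "is_biproduct C (Dom C f) K (Cod C f) f k r c" by blast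
  have "split_mono C f"
    unfolding split_mono_def using biproduct_arr[OF b] biproduct_eq(1)[OF b] by (auto simp: Hom_iff)
  then show "f \<in> split_monos_with_cokernel_in C U"
    using biproduct_is_cokernel[OF b] biproduct_arr[OF b] K
    by (auto simp: split_monos_with_cokernel_in_def)
qed

lemma split_monos_with_cokernel_in_I:
  assumes b: "is_biproduct C X K E f k r c" and K: "K \<in> U"
  shows "f \<in> split_monos_with_cokernel_in C U"
  unfolding split_monos_with_cokernel_in_iff biproduct_arr(2,3)[OF b] using b K by blast

lemma split_monos_with_cokernel_in_E:
  assumes "f \<in> split_monos_with_cokernel_in C U"
  obtains X K E k r c where "is_biproduct C X K E f k r c" "K \<in> U"
proof -
  obtain K where "K \<in> U" "\<exists>k r c. is_biproduct C (Dom C f) K (Cod C f) f k r c"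
    using assms unfolding split_monos_with_cokernel_in_iff by (rule bexE)
  then show thesis
    using that by (elim exE) assumption
qed

lemma Hom_epic_iff:
  "Hom_epic C U f \<longleftrightarrow>
    f \<in> Arr C \<and> (\<forall>T \<in> U. \<forall>v \<in> Hom C T (Cod C f). \<exists>h \<in> Hom C T (Dom C f). f \<cdot> h = v)"
proof (cases "f \<in> Arr C")
  case True
  then have "(\<lambda>h. f \<cdot> h) ` Hom C T (Dom C f) \<subseteq> Hom C T (Cod C f)" for T
    by (auto simp: Hom_iff)
  then have "(\<lambda>h. f \<cdot> h) ` Hom C T (Dom C f) = Hom C T (Cod C f) \<longleftrightarrow>
    (\<forall>v \<in> Hom C T (Cod C f). \<exists>h \<in> Hom C T (Dom C f). f \<cdot> h = v)" for T
    by (simp add: set_eq_subset subset_iff image_iff) metis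
  with True show ?thesis
    by (simp add: Hom_epic_def)
qed (simp add: Hom_epic_def)

text \<open>A map out of a biproduct may be chosen on each summand: \<open>u\<close> on
  \<open>X\<close>, and on \<open>K\<close> a lift \<open>w\<close> of \<open>v \<cdot> k\<close>,
  which exists because \<open>K\<close> is in \<open>U\<close>.\<close>

lemma lifts_Hom_epic:
  assumes f: "f \<in> split_monos_with_cokernel_in C U" and g: "Hom_epic C U g"
  shows "lifts C f g"
proof -
  obtain X K E k r c where b: "is_biproduct C X K E f k r c" and K: "K \<in> U"
    using f by (rule split_monos_with_cokernel_in_E)
  note [simp] = biproduct_arr[OF b] biproduct_eq[OF b] biproduct_Comp[OF b]
  have g': "g \<in> Arr C" using g by (simp add: Hom_epic_def)
  show ?thesis
  proof (rule liftsI[of f X E g "Dom C g" "Cod C g"])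
    fix u v
    assume u: "u \<in> Hom C X (Dom C g)" and v: "v \<in> Hom C E (Cod C g)"
      and sq: "g \<cdot> u = v \<cdot> f"
    note [simp] = u[unfolded Hom_iff] v[unfolded Hom_iff] g'
    have "v \<cdot> k \<in> Hom C K (Cod C g)" by (simp add: Hom_iff)
    then obtain w where w: "w \<in> Hom C K (Dom C g)" "g \<cdot> w = v \<cdot> k"
      using g K unfolding Hom_epic_iff by blast
    note [simp] = w(1)[unfolded Hom_iff]
    let ?h = "(u \<cdot> r) \<oplus> (w \<cdot> c)"
    have "g \<cdot> ?h = v"
      using biproduct_decomp_right[OF b, of v] Comp_cong_left[OF sq, of r] Comp_cong_left[OF w(2), of c]
      by simp
    moreover have "?h \<cdot> f = u"
      using Dom_closed[OF g'] by simp
    ultimately show "\<exists>h \<in> Hom C E (Dom C g). h \<cdot> f = u \<and> g \<cdot> h = v"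
      by (intro bexI[of _ ?h]) (auto simp: Hom_iff)
  qed (use g' in \<open>auto simp: Hom_iff\<close>)
qed

text \<open>The morphism \<open>p'\<close> is the direct sum of \<open>p\<close> with the identity
  of \<open>S\<close>. The class \<open>R\<close> is closed under such sums because the lifting
  problem splits into components.\<close>

lemma wfs_right_biproduct:
  assumes wfs: "weak_factorization_system C L R" and p: "p \<in> R" "Cod C p = Y"
    and b: "is_biproduct C Y S B j k r c"
  obtains E i k' r' c' p' where "is_biproduct C (Dom C p) S E i k' r' c'"
    "p' \<in> R" "p' \<in> Hom C E B" "p' \<cdot> i = j \<cdot> p" "retract_of C p p'"
proof -
  note p' = wfs_arr(2)[OF wfs p(1)]
  note [simp] = p' p(2) biproduct_arr[OF b] biproduct_eq[OF b] biproduct_Comp[OF b]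
  let ?A = "Dom C p"
  have [simp]: "?A \<in> Ob C" using p' by (rule Dom_closed)
  obtain E i k' r' c' where e: "is_biproduct C ?A S E i k' r' c'"
    using biproduct_exists[of ?A S] by auto
  note [simp] = biproduct_arr[OF e] biproduct_eq[OF e] biproduct_Comp[OF e]
  let ?q = "(j \<cdot> (p \<cdot> r')) \<oplus> (k \<cdot> c')"
  have q: "?q \<in> Hom C E B" "?q \<cdot> i = j \<cdot> p" "?q \<cdot> k' = k" "r \<cdot> ?q = p \<cdot> r'" "c \<cdot> ?q = c'"
    by (simp_all add: Hom_iff)
  define q where "q = ?q"
  note q = q[folded q_def]
  note [simp] = q(1)[unfolded Hom_iff]
  have "lifts C l q" if l: "l \<in> L" for l
  proof (rule liftsI[of l "Dom C l" "Cod C l" q E B])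
    fix u v
    assume u: "u \<in> Hom C (Dom C l) E" and v: "v \<in> Hom C (Cod C l) B" and sq: "q \<cdot> u = v \<cdot> l"
    note [simp] = u[unfolded Hom_iff] v[unfolded Hom_iff] wfs_arr(1)[OF wfs l]
    have "p \<cdot> (r' \<cdot> u) = r \<cdot> (q \<cdot> u)"
      using Comp_cong_left[OF q(4), of u] by simp
    then obtain w where w: "w \<in> Hom C (Cod C l) ?A" "w \<cdot> l = r' \<cdot> u" "p \<cdot> w = r \<cdot> v"
      using liftsE[OF wfs_lifts[OF wfs l p(1)], of "Dom C l" "Cod C l" ?A Y "r' \<cdot> u" "r \<cdot> v"] sq
      by (auto simp: Hom_iff)
    note [simp] = w(1)[unfolded Hom_iff]
    have cv: "c \<cdot> (v \<cdot> l) = c' \<cdot> u"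
      using Comp_cong_left[OF q(5), of u] sq by simp
    \<comment> \<open>On the first component \<open>w\<close> solves the problem for
      \<open>p\<close>; on the second, \<open>q\<close> is the identity and forces
      \<open>c \<cdot> v\<close>.\<close>
    let ?h = "(i \<cdot> w) \<oplus> (k' \<cdot> (c \<cdot> v))"
    have "?h \<cdot> l = u"
      using w(2) cv biproduct_decomp_left[OF e, of u] by simp
    moreover have "q \<cdot> ?h = v"
      using w(3) Comp_cong_left[OF q(2), of w] Comp_cong_left[OF q(3), of "c \<cdot> v"]
        biproduct_decomp_left[OF b, of v] by simp
    ultimately show "\<exists>h \<in> Hom C (Cod C l) E. h \<cdot> l = u \<and> q \<cdot> h = v"
      by (intro bexI[of _ ?h]) (auto simp: Hom_iff)
  qed (use wfs_arr(1)[OF wfs l] in \<open>auto simp: Hom_iff\<close>)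
  then have "q \<in> R"
    unfolding wfs_right_iff[OF wfs, of q] by simp
  moreover have "retract_of C p q"
    by (rule retract_ofI[of p ?A Y q E B i r' j r]) (use q in \<open>auto simp: Hom_iff\<close>)
  ultimately show ?thesis
    using that[OF e] q by blast
qed

end

section \<open>The weak factorization system of split monomorphisms\<close>

context wic_additive_category
begin

text \<open>This is where weak idempotent completeness enters: it supplies the cokernel of
  \<open>f\<close>.\<close>

lemma split_mono_biproduct:
  assumes "f \<in> Hom C X E" "r \<in> Hom C E X" "r \<cdot> f = Ident C X"
  obtains K k c where "is_biproduct C X K E f k r c"
proof -
  have "split_mono C f"
    using assms by (auto simp: split_mono_def Hom_iff)
  then obtain c where "is_cokernel C f c"
    using split_mono_cokernel by blast
  then show ?thesis
    using cokernel_biproduct[OF assms] that by blast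
qed

text \<open>A right \<open>U\<close>-approximation of the codomain gives the factorizations. The
  retract argument shows that a morphism lifting against all epic ones splits, with cokernel a
  retract of an object of \<open>U\<close>.\<close>

lemma split_weak_factorization_system:
  assumes ob: "U \<subseteq> Ob C" and fin: "contravariantly_finite C U"
    and retr: "\<And>K T s t. \<lbrakk>T \<in> U; s \<in> Hom C K T; t \<in> Hom C T K; t \<cdot> s = Ident C K\<rbrakk> \<Longrightarrow> K \<in> U"
  shows "weak_factorization_system C (split_monos_with_cokernel_in C U) {f. Hom_epic C U f}"
    (is "weak_factorization_system C ?J ?F")
proof -
  have J: "?J \<subseteq> Arr C"
    by (auto simp: split_monos_with_cokernel_in_def split_mono_def)
  have F: "?F \<subseteq> Arr C"
    by (auto simp: Hom_epic_def)
  have factor: "\<exists>i \<in> ?J. \<exists>p \<in> ?F. Dom C p = Cod C i \<and> f = p \<cdot> i" if f: "f \<in> Arr C" for f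
  proof -
    have o: "Dom C f \<in> Ob C" "Cod C f \<in> Ob C"
      using f Dom_closed Cod_closed by auto
    obtain t T where T: "T \<in> U" and t: "t \<in> Hom C T (Cod C f)"
      and appr: "\<And>T' s. \<lbrakk>T' \<in> U; s \<in> Hom C T' (Cod C f)\<rbrakk> \<Longrightarrow> \<exists>h \<in> Hom C T' T. s = t \<cdot> h"
      using fin o unfolding contravariantly_finite_def right_approximation_def by meson
    obtain S i k r c where b: "is_biproduct C (Dom C f) T S i k r c"
      using biproduct_exists[of "Dom C f" T] o T ob by blast
    note [simp] = biproduct_arr[OF b] biproduct_eq[OF b] biproduct_Comp[OF b] t[unfolded Hom_iff] f o
    \<comment> \<open>The row \<open>(f, t)\<close> on the biproduct of the domain with
      \<open>T\<close>; it is epic since every map from \<open>U\<close> already factors through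
      \<open>t\<close>.\<close>
    define p where "p = (f \<cdot> r) \<oplus> (t \<cdot> c)"
    have p: "p \<in> Arr C" "Dom C p = S" "Cod C p = Cod C f" "p \<cdot> i = f" "p \<cdot> k = t"
      by (simp_all add: p_def)
    have "\<exists>h \<in> Hom C T' S. p \<cdot> h = v" if v: "T' \<in> U" "v \<in> Hom C T' (Cod C f)" for T' v
    proof -
      obtain h where h: "h \<in> Hom C T' T" "v = t \<cdot> h"
        using appr[OF v] by blast
      then have "p \<cdot> (k \<cdot> h) = v"
        using Comp_cong_left[OF p(5), of h] p(1,2) by (simp add: Hom_iff)
      then show ?thesis
        using h by (intro bexI[of _ "k \<cdot> h"]) (auto simp: Hom_iff)
    qed
    then have "p \<in> ?F"
      using p by (simp add: Hom_epic_iff)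
    moreover have "i \<in> ?J"
      by (rule split_monos_with_cokernel_in_I[OF b T])
    moreover have "Dom C p = Cod C i \<and> f = p \<cdot> i"
      by (simp add: p)
    ultimately show ?thesis by blast
  qed
  have left: "g \<in> ?J" if g: "g \<in> Arr C" and lift: "\<And>r. r \<in> ?F \<Longrightarrow> lifts C g r" for g
  proof -
    obtain i p where ip: "i \<in> ?J" "p \<in> ?F" "Dom C p = Cod C i" "g = p \<cdot> i"
      using factor[OF g] by blast
    have p: "p \<in> Arr C" using ip F by blast
    obtain X T E k r c where b: "is_biproduct C X T E i k r c" and T: "T \<in> U"
      using ip(1) by (rule split_monos_with_cokernel_in_E)
    note [simp] = biproduct_arr[OF b] biproduct_eq[OF b] biproduct_Comp[OF b] p ip(3)
    let ?B = "Cod C p"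
    have [simp]: "?B \<in> Ob C" using p by (rule Cod_closed)
    obtain h where h: "h \<in> Hom C ?B E" "h \<cdot> g = i" "p \<cdot> h = Ident C ?B"
      by (rule liftsE[OF lift[OF ip(2)], of X ?B E ?B i "Ident C ?B"])
         (auto simp: Hom_iff ip(4))
    have [simp]: "g \<in> Arr C" "Dom C g = X" "Cod C g = ?B" using ip(4) by auto
    note [simp] = h(1)[unfolded Hom_iff]
    \<comment> \<open>The equation \<open>h \<cdot> g = i\<close> turns the retraction
      \<open>r\<close> of \<open>i\<close> into a retraction of \<open>g\<close>.\<close>
    obtain K k' c' where b': "is_biproduct C X K ?B g k' (r \<cdot> h) c'"
      by (rule split_mono_biproduct[of g X ?B "r \<cdot> h"]) (auto simp: Hom_iff h(2))
    note [simp] = biproduct_arr[OF b'] biproduct_eq(1-4)[OF b'] biproduct_Comp[OF b']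
    \<comment> \<open>The maps \<open>h\<close> and \<open>p\<close> induce maps between the
      cokernels \<open>K\<close> and \<open>T\<close>; they will exhibit \<open>K\<close> as a
      retract of \<open>T\<close>.\<close>
    let ?s = "c \<cdot> (h \<cdot> k')" and ?t = "c' \<cdot> (p \<cdot> k)"
    have "p \<cdot> (h \<cdot> k') = k'"
      using Comp_cong_left[OF h(3), of k'] by simp
    then have eq: "c' \<cdot> (p \<cdot> (h \<cdot> k')) = Ident C K" by simp
    \<comment> \<open>Decomposing \<open>h \<cdot> k'\<close> over the biproduct, the part through
      \<open>i\<close> dies because \<open>p \<cdot> i = g\<close> and \<open>c'\<close> kills
      \<open>g\<close>. Only the part through \<open>T\<close> is left.\<close>
    have "(c' \<cdot> p) \<cdot> (i \<cdot> (r \<cdot> (h \<cdot> k'))) = c' \<cdot> (g \<cdot> (r \<cdot> (h \<cdot> k')))"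
      using ip(4) by simp
    also have "\<dots> = Null C K K"
      by simp
    finally have z: "(c' \<cdot> p) \<cdot> (i \<cdot> (r \<cdot> (h \<cdot> k'))) = Null C K K" .
    have "(c' \<cdot> p) \<cdot> (h \<cdot> k') =
        (c' \<cdot> p) \<cdot> ((i \<cdot> (r \<cdot> (h \<cdot> k'))) \<oplus> (k \<cdot> (c \<cdot> (h \<cdot> k'))))"
      using biproduct_decomp_left[OF b, of "h \<cdot> k'"] by simp
    also have "\<dots> = ((c' \<cdot> p) \<cdot> (i \<cdot> (r \<cdot> (h \<cdot> k')))) \<oplus> ((c' \<cdot> p) \<cdot> (k \<cdot> (c \<cdot> (h \<cdot> k'))))"
      by (rule Comp_Add_arr) auto
    also have "\<dots> = ?t \<cdot> ?s"
      unfolding z by simp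
    finally have "?t \<cdot> ?s = Ident C K"
      using eq by simp
    then have "K \<in> U"
      using T by (intro retr[of T ?s K ?t]) (auto simp: Hom_iff)
    then show ?thesis
      by (rule split_monos_with_cokernel_in_I[OF b'])
  qed
  \<comment> \<open>A retract of a morphism in \<open>?J\<close> still lifts against
    \<open>?F\<close>, so \<open>left\<close> applies.\<close>
  have "retract_closed C ?J"
    unfolding retract_closed_def
    using J F by (blast intro: left lifts_retract_left lifts_Hom_epic)
  moreover have "g \<in> ?F" if f: "f \<in> ?F" and g: "g \<in> Arr C" and gf: "retract_of C g f" for f g
  proof -
    let ?X' = "Dom C g" and ?Y' = "Cod C g" and ?X = "Dom C f" and ?Y = "Cod C f"
    obtain \<phi>\<^sub>1 \<psi>\<^sub>1 \<phi>\<^sub>2 \<psi>\<^sub>2 where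
      hom: "\<phi>\<^sub>1 \<in> Hom C ?X' ?X" "\<psi>\<^sub>1 \<in> Hom C ?X ?X'" "\<phi>\<^sub>2 \<in> Hom C ?Y' ?Y" "\<psi>\<^sub>2 \<in> Hom C ?Y ?Y'"
      and eq: "g \<cdot> \<psi>\<^sub>1 = \<psi>\<^sub>2 \<cdot> f" "\<psi>\<^sub>2 \<cdot> \<phi>\<^sub>2 = Ident C ?Y'"
      using gf unfolding retract_of_def by blast
    note [simp] = hom[unfolded Hom_iff] g
    have f': "f \<in> Arr C" using f F by blast
    have "\<exists>h \<in> Hom C T ?X'. g \<cdot> h = v" if T: "T \<in> U" and v: "v \<in> Hom C T ?Y'" for T v
    proof -
      note [simp] = v[unfolded Hom_iff] f'
      have "\<phi>\<^sub>2 \<cdot> v \<in> Hom C T ?Y" by (simp add: Hom_iff)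
      then obtain h where h: "h \<in> Hom C T ?X" "f \<cdot> h = \<phi>\<^sub>2 \<cdot> v"
        using f T unfolding Hom_epic_iff by blast
      then have "g \<cdot> (\<psi>\<^sub>1 \<cdot> h) = v"
        using Comp_cong_left[OF eq(1), of h] Comp_cong_left[OF eq(2), of v] by (simp add: Hom_iff)
      then show ?thesis
        using h by (intro bexI[of _ "\<psi>\<^sub>1 \<cdot> h"]) (auto simp: Hom_iff)
    qed
    then show ?thesis
      using g by (simp add: Hom_epic_iff)
  qed
  ultimately show ?thesis
    unfolding weak_factorization_system_def has_factorizations_def retract_closed_def
    using J F factor lifts_Hom_epic by blast
qed

text \<open>Relative projectivity and relative injectivity both pass to retracts: extend the problem
  to \<open>T\<close>, solve it, and restrict.\<close>

lemma objects_retract: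
  assumes wfs: "weak_factorization_system C L R"
    and T: "T \<in> objects_from_zero_in C L \<inter> objects_to_zero_in C R"
    and s: "s \<in> Hom C K T" and t: "t \<in> Hom C T K" and ts: "t \<cdot> s = Ident C K"
  shows "K \<in> objects_from_zero_in C L \<inter> objects_to_zero_in C R"
proof -
  note [simp] = s[unfolded Hom_iff] t[unfolded Hom_iff]
  have K: "K \<in> Ob C" using Hom_objects[OF s] by simp
  have "\<exists>h \<in> Hom C K (Dom C r). r \<cdot> h = v" if r: "r \<in> R" and v: "v \<in> Hom C K (Cod C r)" for r v
  proof -
    note [simp] = wfs_arr(2)[OF wfs r] v[unfolded Hom_iff]
    have "v \<cdot> t \<in> Hom C T (Cod C r)" by (simp add: Hom_iff)
    then obtain h where h: "h \<in> Hom C T (Dom C r)" "r \<cdot> h = v \<cdot> t"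
      using T r unfolding Int_iff objects_from_zero_iff[OF wfs] by blast
    have "r \<cdot> (h \<cdot> s) = v"
      using Comp_cong_left[OF h(2), of s] h(1) by (simp add: Hom_iff ts)
    then show ?thesis
      using h(1) by (intro bexI[of _ "h \<cdot> s"]) (auto simp: Hom_iff)
  qed
  moreover have "\<exists>h \<in> Hom C (Cod C l) K. h \<cdot> l = u" if l: "l \<in> L" and u: "u \<in> Hom C (Dom C l) K" for l u
  proof -
    note [simp] = wfs_arr(1)[OF wfs l] u[unfolded Hom_iff]
    have "s \<cdot> u \<in> Hom C (Dom C l) T" by (simp add: Hom_iff)
    then obtain h where h: "h \<in> Hom C (Cod C l) T" "h \<cdot> l = s \<cdot> u"
      using T l unfolding Int_iff objects_to_zero_iff[OF wfs] by blast
    have "(t \<cdot> h) \<cdot> l = u"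
      using Comp_cong_left[OF ts, of u] h by (simp add: Hom_iff)
    then show ?thesis
      using h(1) by (intro bexI[of _ "t \<cdot> h"]) (auto simp: Hom_iff)
  qed
  ultimately show ?thesis
    unfolding Int_iff objects_from_zero_iff[OF wfs] objects_to_zero_iff[OF wfs] using K by blast
qed

end

section \<open>From fibrantly weak factorization systems to fibrant model structures\<close>

locale fibrant_wfs = wic_additive_category C for C :: "('o, 'm, 'x) acat_scheme" (structure) +
  fixes L R :: "'m set"
  assumes fwfs: "fibrantly_weak_factorization_system C L R"
begin

text \<open>With \<open>L\<close> as cofibrations and \<open>R\<close> as trivial fibrations,
  \<open>U\<close> is the class of trivially cofibrant objects, while \<open>J\<close>,
  \<open>F\<close> and \<open>W\<close> are the trivial cofibrations, fibrations and weak
  equivalences assigned by \<open>Phi\<close>.\<close>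

abbreviation U where "U \<equiv> objects_from_zero_in C L \<inter> objects_to_zero_in C R"
abbreviation J where "J \<equiv> split_monos_with_cokernel_in C U"
abbreviation F where "F \<equiv> {f. Hom_epic C U f}"
abbreviation W where "W \<equiv> composites C R J"

lemma wfs: "weak_factorization_system C L R"
  using fwfs by (simp add: fibrantly_weak_factorization_system_def)

lemma wfs': "weak_factorization_system C J F"
proof (rule split_weak_factorization_system)
  show "U \<subseteq> Ob C" by (auto simp: objects_from_zero_in_def)
  show "contravariantly_finite C U"
    using fwfs by (simp add: fibrantly_weak_factorization_system_def)
qed (rule objects_retract[OF wfs])

lemma right_cancel: "\<lbrakk>f \<in> R; g \<in> Arr C; Dom C g = Cod C f; g \<cdot> f \<in> R\<rbrakk> \<Longrightarrow> g \<in> R"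
  using fwfs wfs_arr(2)[OF wfs] unfolding fibrantly_weak_factorization_system_def by blast

text \<open>Objects of \<open>U\<close> are projective relative to \<open>R\<close>.\<close>

lemma right_subset: "R \<subseteq> F"
proof
  fix r assume r: "r \<in> R"
  have "\<exists>h \<in> Hom C T (Dom C r). r \<cdot> h = v" if "T \<in> U" "v \<in> Hom C T (Cod C r)" for T v
    using that r unfolding Int_iff objects_from_zero_iff[OF wfs] by blast
  then show "r \<in> F"
    unfolding mem_Collect_eq Hom_epic_iff using wfs_arr(2)[OF wfs r] by blast
qed

text \<open>Passing to lifting classes reverses the inclusion of \<open>R\<close> in
  \<open>F\<close>.\<close>

lemma J_subset: "J \<subseteq> L"
proof
  fix j assume j: "j \<in> J"
  then show "j \<in> L"
    unfolding wfs_left_iff[OF wfs, of j] using wfs_arr(1)[OF wfs' j] wfs_lifts[OF wfs' j] right_subset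
    by blast
qed

text \<open>
  Lifting gives maps \<open>\<phi>\<close> and \<open>\<psi>\<close> between the middle objects for which \<open>p'\<close> would be a retract of
  \<open>p\<close>, except that \<open>\<psi> \<cdot> \<phi>\<close> need not be the identity. The error is the identity minus \<open>\<psi> \<cdot> \<phi>\<close>;
  it vanishes on \<open>i'\<close>, so it factors through an object of \<open>U\<close>, along which maps extend over \<open>L\<close>.
\<close>

lemma retract_right_factor:
  assumes p: "p \<in> R" and i: "i \<in> J" and pi: "Dom C p = Cod C i"
    and p': "p' \<in> F" and i': "i' \<in> J" and pi': "Dom C p' = Cod C i'"
    and retr: "retract_of C (p' \<cdot> i') (p \<cdot> i)"
  shows "p' \<in> R"
proof -
  note [simp] = wfs_arr(2)[OF wfs p] wfs_arr(1)[OF wfs' i] wfs_arr(2)[OF wfs' p'] wfs_arr(1)[OF wfs' i'] pi pi'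
  let ?X = "Dom C i" and ?E = "Cod C i" and ?Y = "Cod C p"
  let ?X' = "Dom C i'" and ?E' = "Cod C i'" and ?Y' = "Cod C p'"
  have d: "Dom C (p' \<cdot> i') = ?X'" "Cod C (p' \<cdot> i') = ?Y'" "Dom C (p \<cdot> i) = ?X" "Cod C (p \<cdot> i) = ?Y"
    by simp_all
  obtain a b e f where
    hom: "a \<in> Hom C ?X' ?X" "b \<in> Hom C ?X ?X'" "e \<in> Hom C ?Y' ?Y" "f \<in> Hom C ?Y ?Y'"
    and eq: "(p \<cdot> i) \<cdot> a = e \<cdot> (p' \<cdot> i')" "(p' \<cdot> i') \<cdot> b = f \<cdot> (p \<cdot> i)"
      "b \<cdot> a = Ident C ?X'" "f \<cdot> e = Ident C ?Y'"
    using retr unfolding retract_of_def d by blast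
  note [simp] = hom[unfolded Hom_iff]
  have pF: "p \<in> F" using p right_subset by blast
  obtain \<phi> where \<phi>: "\<phi> \<in> Hom C ?E' ?E" "\<phi> \<cdot> i' = i \<cdot> a" "p \<cdot> \<phi> = e \<cdot> p'"
    by (rule liftsE[OF wfs_lifts[OF wfs' i' pF], of ?X' ?E' ?E ?Y "i \<cdot> a" "e \<cdot> p'"])
       (use eq(1) in \<open>simp_all add: Hom_iff\<close>)
  obtain \<psi> where \<psi>: "\<psi> \<in> Hom C ?E ?E'" "\<psi> \<cdot> i = i' \<cdot> b" "p' \<cdot> \<psi> = f \<cdot> p"
    by (rule liftsE[OF wfs_lifts[OF wfs' i p'], of ?X ?E ?E' ?Y' "i' \<cdot> b" "f \<cdot> p"])
       (use eq(2) in \<open>simp_all add: Hom_iff\<close>)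
  note [simp] = \<phi>(1)[unfolded Hom_iff] \<psi>(1)[unfolded Hom_iff]
  obtain X' T E' k r c where bip: "is_biproduct C X' T E' i' k r c" and T: "T \<in> U"
    using i' by (rule split_monos_with_cokernel_in_E)
  note [simp] = biproduct_arr[OF bip] biproduct_eq[OF bip] biproduct_Comp[OF bip]
  have ob [simp]: "?Y' \<in> Ob C" using wfs_arr(2)[OF wfs' p'] by (rule Cod_closed)
  obtain \<epsilon> where \<epsilon>: "\<epsilon> \<in> Hom C E' E'" "(\<psi> \<cdot> \<phi>) \<oplus> \<epsilon> = Ident C E'"
    using difference_exists[of "Ident C E'" E' E' "\<psi> \<cdot> \<phi>"] by (auto simp: Hom_iff)
  note [simp] = \<epsilon>(1)[unfolded Hom_iff]
  have "(\<psi> \<cdot> \<phi>) \<cdot> i' = i'"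
    using \<phi>(2) Comp_cong_left[OF \<psi>(2), of a] eq(3) by simp
  moreover have "((\<psi> \<cdot> \<phi>) \<oplus> \<epsilon>) \<cdot> i' = ((\<psi> \<cdot> \<phi>) \<cdot> i') \<oplus> (\<epsilon> \<cdot> i')"
    by (rule Add_Comp_arr) auto
  ultimately have \<epsilon>i: "\<epsilon> \<cdot> i' = Null C X' E'"
    unfolding \<epsilon>(2) by (intro Add_left_cancel[of _ _ _ i']) (auto simp: Hom_iff)
  have "p' \<cdot> (\<psi> \<cdot> \<phi>) = p'"
    using \<phi>(3) Comp_cong_left[OF \<psi>(3), of \<phi>] Comp_cong_left[OF eq(4), of p'] by simp
  moreover have "p' \<cdot> ((\<psi> \<cdot> \<phi>) \<oplus> \<epsilon>) = (p' \<cdot> (\<psi> \<cdot> \<phi>)) \<oplus> (p' \<cdot> \<epsilon>)"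
    by (rule Comp_Add_arr) auto
  ultimately have p\<epsilon>: "p' \<cdot> \<epsilon> = Null C E' ?Y'"
    unfolding \<epsilon>(2) by (intro Add_left_cancel[of _ _ _ p']) (auto simp: Hom_iff)
  have "\<epsilon> \<cdot> (i' \<cdot> r) = Null C E' E'"
    using Comp_cong_left[OF \<epsilon>i, of r] by simp
  with biproduct_decomp_right[OF bip, of \<epsilon>] have \<epsilon>kc: "\<epsilon> \<cdot> (k \<cdot> c) = \<epsilon>"
    by simp
  have "lifts C l p'" if l: "l \<in> L" for l
  proof (rule liftsI[of l "Dom C l" "Cod C l" p' E' ?Y'])
    note [simp] = wfs_arr(1)[OF wfs l]
    fix u v
    assume u: "u \<in> Hom C (Dom C l) E'" and v: "v \<in> Hom C (Cod C l) ?Y'" and sq: "p' \<cdot> u = v \<cdot> l"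
    note [simp] = u[unfolded Hom_iff] v[unfolded Hom_iff]
    have "p \<cdot> (\<phi> \<cdot> u) = (e \<cdot> v) \<cdot> l"
      using Comp_cong_left[OF \<phi>(3), of u] sq by simp
    then obtain w where w: "w \<in> Hom C (Cod C l) ?E" "w \<cdot> l = \<phi> \<cdot> u" "p \<cdot> w = e \<cdot> v"
      using liftsE[OF wfs_lifts[OF wfs l p], of "Dom C l" "Cod C l" ?E ?Y "\<phi> \<cdot> u" "e \<cdot> v"]
      by (auto simp: Hom_iff)
    have "c \<cdot> u \<in> Hom C (Dom C l) T" by (simp add: Hom_iff)
    then obtain z where z: "z \<in> Hom C (Cod C l) T" "z \<cdot> l = c \<cdot> u"
      using T l unfolding Int_iff objects_to_zero_iff[OF wfs] by blast
    note [simp] = w(1)[unfolded Hom_iff] z(1)[unfolded Hom_iff]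
    \<comment> \<open>Along \<open>l\<close> the first summand gives
      \<open>\<psi> \<cdot> \<phi> \<cdot> u\<close> and the second restores the missing
      \<open>\<epsilon> \<cdot> u\<close>. The correction is invisible to \<open>p'\<close>, which
      kills \<open>\<epsilon>\<close>.\<close>
    let ?h = "(\<psi> \<cdot> w) \<oplus> (\<epsilon> \<cdot> (k \<cdot> z))"
    have "?h \<cdot> l = (\<psi> \<cdot> (\<phi> \<cdot> u)) \<oplus> (\<epsilon> \<cdot> u)"
      using w(2) z(2) Comp_cong_left[OF \<epsilon>kc, of u] by simp
    also have "\<dots> = ((\<psi> \<cdot> \<phi>) \<oplus> \<epsilon>) \<cdot> u"
      by simp
    also have "\<dots> = u"
      unfolding \<epsilon>(2) by simp
    finally have "?h \<cdot> l = u" .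
    moreover have "p' \<cdot> (\<psi> \<cdot> w) = v"
      using Comp_cong_left[OF \<psi>(3), of w] w(3) Comp_cong_left[OF eq(4), of v] by simp
    then have "p' \<cdot> ?h = v"
      using Comp_cong_left[OF p\<epsilon>, of "k \<cdot> z"] by simp
    ultimately show "\<exists>h \<in> Hom C (Cod C l) E'. h \<cdot> l = u \<and> p' \<cdot> h = v"
      by (intro bexI[of _ ?h]) (auto simp: Hom_iff)
  qed (use wfs_arr(1)[OF wfs l] in \<open>auto simp: Hom_iff\<close>)
  then show ?thesis
    unfolding wfs_right_iff[OF wfs, of p'] by simp
qed

section \<open>The class of weak equivalences and its intersections with \<open>F\<close> and
  \<open>L\<close>\<close>

lemma W_subset: "W \<subseteq> Arr C"
  using wfs_arr(2)[OF wfs] wfs_arr(1)[OF wfs'] by (auto simp: composites_def)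

lemma W_I: "\<lbrakk>p \<in> R; i \<in> J; Dom C p = Cod C i\<rbrakk> \<Longrightarrow> p \<cdot> i \<in> W"
  unfolding composites_def by blast

lemma W_retract_right_factor:
  assumes "f \<in> W" "retract_of C (p \<cdot> i) f" "p \<in> F" "i \<in> J" "Dom C p = Cod C i"
  shows "p \<in> R"
proof -
  obtain p' i' where "p' \<in> R" "i' \<in> J" "Dom C p' = Cod C i'" "f = p' \<cdot> i'"
    using assms(1) unfolding composites_def by blast
  then show ?thesis
    using retract_right_factor assms by blast
qed

text \<open>A morphism is a retract of itself, so the criterion holds for every factorization
  through \<open>J\<close> and \<open>F\<close>, not only for one witnessing membership in
  \<open>W\<close>.\<close>

lemma W_right_factor:
  assumes "p \<cdot> i \<in> W" "p \<in> F" "i \<in> J" "Dom C p = Cod C i"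
  shows "p \<in> R"
  using W_retract_right_factor[OF assms(1) retract_of_refl] assms W_subset by blast

lemma W_factor:
  assumes "f \<in> Arr C"
  obtains p i where "p \<in> F" "i \<in> J" "Dom C p = Cod C i" "f = p \<cdot> i"
  using wfs_factor[OF wfs' assms] by blast

text \<open>Factor the retract through \<open>J\<close> and \<open>F\<close>; its right factor lies
  in \<open>R\<close> by the criterion.\<close>

lemma retract_closed_W: "retract_closed C W"
  unfolding retract_closed_def
proof (intro ballI impI)
  fix f g assume fg: "f \<in> W" "g \<in> Arr C" "retract_of C g f"
  obtain p i where "p \<in> F" "i \<in> J" "Dom C p = Cod C i" "g = p \<cdot> i"
    using fg(2) by (rule W_factor)
  then show "g \<in> W"
    using W_I W_retract_right_factor fg by blast
qed

lemma Ident_J: "X \<in> Ob C \<Longrightarrow> Ident C X \<in> J"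
  using wfs_left_iff[OF wfs', of "Ident C X"] wfs_arr(2)[OF wfs'] by (auto simp: lifts_def Hom_iff)

lemma right_subset_W: "R \<subseteq> W"
proof
  fix r assume r: "r \<in> R"
  note r' = wfs_arr(2)[OF wfs r]
  have "r \<cdot> Ident C (Dom C r) \<in> W"
    by (rule W_I[OF r Ident_J]) (use r' in \<open>auto simp: Dom_closed\<close>)
  then show "r \<in> W"
    using r' by simp
qed

lemma J_subset_W: "J \<subseteq> W"
proof
  fix j assume j: "j \<in> J"
  note j' = wfs_arr(1)[OF wfs' j]
  have "Ident C (Cod C j) \<cdot> j \<in> W"
    by (rule W_I[OF wfs_right_Ident[OF wfs] j]) (use j' in \<open>auto simp: Cod_closed\<close>)
  then show "j \<in> W"
    using j' by simp
qed

text \<open>For \<open>f\<close> in \<open>F\<close> the trivial factorization through the identity,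
  which is in \<open>J\<close>, is admissible for the criterion.\<close>

lemma F_Int_W: "F \<inter> W = R"
proof
  show "F \<inter> W \<subseteq> R"
  proof
    fix f assume f: "f \<in> F \<inter> W"
    then have f': "f \<in> Arr C" using W_subset by blast
    then have "f \<cdot> Ident C (Dom C f) = f" by simp
    then show "f \<in> R"
      using W_right_factor[of f "Ident C (Dom C f)"] f f' Ident_J[of "Dom C f"] by (auto simp: Dom_closed)
  qed
qed (use right_subset right_subset_W in blast)

text \<open>If \<open>f = p \<cdot> i\<close> is in \<open>L\<close>, it lifts against
  \<open>p\<close> in \<open>R\<close>, hence is a retract of \<open>i\<close> in
  \<open>J\<close>.\<close>

lemma L_Int_W: "L \<inter> W = J"
proof
  show "L \<inter> W \<subseteq> J"
  proof
    fix f assume f: "f \<in> L \<inter> W"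
    then obtain p i where pi: "p \<in> R" "i \<in> J" "Dom C p = Cod C i" "f = p \<cdot> i"
      unfolding composites_def by blast
    have "lifts C f p" using f pi(1) wfs_lifts[OF wfs] by blast
    then have "retract_of C f i"
      unfolding pi(4)
      by (rule retract_of_left_factor[rotated 3])
         (use pi wfs_arr(2)[OF wfs] wfs_arr(1)[OF wfs'] in auto)
    then show "f \<in> J"
      using wfs_retract(1)[OF wfs'] pi(2) f W_subset by blast
  qed
qed (use J_subset J_subset_W in blast)

text \<open>
  The left factor of \<open>f\<close> with respect to \<open>(L, R)\<close> lifts against \<open>q \<cdot> f\<close>, so it splits; its
  cokernel is in \<open>U\<close> because \<open>q \<cdot> f\<close> and its composite with the retraction are both in \<open>R\<close>.
\<close>

lemma right_cancel_left:
  assumes q: "q \<in> R" and f: "f \<in> F" and qf: "Dom C q = Cod C f" "q \<cdot> f \<in> R"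
  shows "f \<in> R"
proof -
  note [simp] = wfs_arr(2)[OF wfs q] wfs_arr(2)[OF wfs' f] qf(1)
  obtain l r where lr: "l \<in> L" "r \<in> R" "Dom C r = Cod C l" "f = r \<cdot> l"
    using wfs_arr(2)[OF wfs' f] by (rule wfs_factor[OF wfs])
  note [simp] = wfs_arr(1)[OF wfs lr(1)] wfs_arr(2)[OF wfs lr(2)] lr(3)
  define X E Z where "X = Dom C l" and "E = Cod C l" and "Z = Cod C q"
  have [simp]: "Dom C l = X" "Cod C l = E" "Cod C q = Z" "Dom C f = X" "Cod C r = Cod C f"
    by (simp_all add: X_def E_def Z_def lr(4))
  have ob [simp]: "X \<in> Ob C" "E \<in> Ob C" "Z \<in> Ob C"
    using Dom_closed[of l] Cod_closed[of l] Cod_closed[of q] by simp_all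
  obtain h where h: "h \<in> Hom C E X" "h \<cdot> l = Ident C X" "(q \<cdot> f) \<cdot> h = q \<cdot> r"
    by (rule liftsE[OF wfs_lifts[OF wfs lr(1) qf(2)], of X E X Z "Ident C X" "q \<cdot> r"])
       (simp_all add: Hom_iff lr(4)[symmetric])
  note [simp] = h(1)[unfolded Hom_iff]
  obtain K k c where b: "is_biproduct C X K E l k h c"
    using split_mono_biproduct[of l X E h] h by (auto simp: Hom_iff)
  note [simp] = biproduct_arr[OF b] biproduct_eq[OF b] biproduct_Comp[OF b]
  have qr: "q \<cdot> r \<in> R"
    by (rule wfs_right_Comp[OF wfs lr(2) q]) simp
  have "(q \<cdot> r) \<cdot> k = (q \<cdot> f) \<cdot> (h \<cdot> k)"
    unfolding h(3)[symmetric] by (rule Comp_assoc_arr) simp_all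
  also have "\<dots> = Null C K Z"
    by simp
  finally have qrk: "(q \<cdot> r) \<cdot> k = Null C K Z" .
  \<comment> \<open>Projectivity of \<open>K\<close>: lift \<open>v \<cdot> c\<close> along
    \<open>s\<close> with zero on \<open>X\<close>, then restrict along \<open>k\<close>.\<close>
  have "\<exists>g \<in> Hom C K (Dom C s). s \<cdot> g = v" if s: "s \<in> R" and v: "v \<in> Hom C K (Cod C s)" for s v
  proof -
    note [simp] = wfs_arr(2)[OF wfs s] v[unfolded Hom_iff]
    have [simp]: "Dom C s \<in> Ob C" "Cod C s \<in> Ob C" by (simp_all add: Dom_closed Cod_closed)
    obtain g where g: "g \<in> Hom C E (Dom C s)" "s \<cdot> g = v \<cdot> c"
      by (rule liftsE[OF wfs_lifts[OF wfs lr(1) s], of X E "Dom C s" "Cod C s" "Null C X (Dom C s)" "v \<cdot> c"])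
         (simp_all add: Hom_iff)
    have "s \<cdot> (g \<cdot> k) = v"
      using Comp_cong_left[OF g(2), of k] g(1) by (simp add: Hom_iff)
    then show ?thesis
      using g(1) by (intro bexI[of _ "g \<cdot> k"]) (auto simp: Hom_iff)
  qed
  \<comment> \<open>Injectivity of \<open>K\<close>: since \<open>q \<cdot> r\<close> kills
    \<open>k\<close>, the square with top \<open>k \<cdot> u\<close> and zero bottom commutes;
    project its lift by \<open>c\<close>.\<close>
  moreover have "\<exists>g \<in> Hom C (Cod C m) K. g \<cdot> m = u" if m: "m \<in> L" and u: "u \<in> Hom C (Dom C m) K" for m u
  proof -
    note [simp] = wfs_arr(1)[OF wfs m] u[unfolded Hom_iff]
    have [simp]: "Dom C m \<in> Ob C" "Cod C m \<in> Ob C" by (simp_all add: Dom_closed Cod_closed)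
    obtain g where g: "g \<in> Hom C (Cod C m) E" "g \<cdot> m = k \<cdot> u"
      by (rule liftsE[OF wfs_lifts[OF wfs m qr], of "Dom C m" "Cod C m" E Z "k \<cdot> u" "Null C (Cod C m) Z"])
         (use Comp_cong_left[OF qrk, of u] in \<open>simp_all add: Hom_iff\<close>)
    have "(c \<cdot> g) \<cdot> m = u"
      using g by (simp add: Hom_iff)
    then show ?thesis
      using g(1) by (intro bexI[of _ "c \<cdot> g"]) (auto simp: Hom_iff)
  qed
  ultimately have "K \<in> U"
    unfolding Int_iff objects_from_zero_iff[OF wfs] objects_to_zero_iff[OF wfs] by simp
  then have "l \<in> J"
    by (rule split_monos_with_cokernel_in_I[OF b])
  then have "f \<in> W"
    using W_I[OF lr(2)] lr by simp
  then show ?thesis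
    using f F_Int_W by blast
qed

text \<open>Exchanges the order of factors: \<open>p'\<close> is the sum of \<open>p\<close> with
  the identity of the cokernel of \<open>j\<close>. The system is arbitrary because both
  \<open>(L, R)\<close> and \<open>(J, F)\<close> are needed.\<close>

lemma J_Comp_right:
  assumes wfs2: "weak_factorization_system C L' R'" and p: "p \<in> R'" and j: "j \<in> J" "Dom C j = Cod C p"
  obtains i p' where "i \<in> J" "p' \<in> R'" "Dom C p' = Cod C i" "Dom C i = Dom C p" "Cod C p' = Cod C j"
    "p' \<cdot> i = j \<cdot> p" "retract_of C p p'"
proof -
  obtain X T B k r c where b: "is_biproduct C X T B j k r c" and T: "T \<in> U"
    using j(1) by (rule split_monos_with_cokernel_in_E)
  have X: "Cod C p = X" "Cod C j = B" using biproduct_arr[OF b] j(2) by simp_all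
  obtain E i k' r' c' p' where e: "is_biproduct C (Dom C p) T E i k' r' c'"
      and p': "p' \<in> R'" "p' \<in> Hom C E B" "p' \<cdot> i = j \<cdot> p" "retract_of C p p'"
    by (rule wfs_right_biproduct[OF wfs2 p X(1) b])
  show ?thesis
    by (rule that[OF split_monos_with_cokernel_in_I[OF e T] p'(1) _ _ _ p'(3,4)])
       (use p'(2) biproduct_arr[OF e] X in \<open>auto simp: Hom_iff\<close>)
qed

text \<open>Exchanging the inner factors \<open>j\<close> and \<open>p\<close> makes
  \<open>g \<cdot> f\<close> a morphism of \<open>J\<close> followed by \<open>q \<cdot> p'\<close>.
  The three cases become closure of \<open>R\<close> under composition, its cancellation axiom, and
  \<open>right_cancel_left\<close>.\<close>

lemma two_out_of_three_W: "two_out_of_three C W"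
  unfolding two_out_of_three_def
proof (intro ballI impI conjI; (elim conjE)?)
  fix f g assume f: "f \<in> Arr C" and g: "g \<in> Arr C" and gf: "Dom C g = Cod C f"
  obtain p i where pi: "p \<in> F" "i \<in> J" "Dom C p = Cod C i" "f = p \<cdot> i"
    using f by (rule W_factor)
  obtain q j where qj: "q \<in> F" "j \<in> J" "Dom C q = Cod C j" "g = q \<cdot> j"
    using g by (rule W_factor)
  note [simp] = wfs_arr(2)[OF wfs' pi(1)] wfs_arr(1)[OF wfs' pi(2)] pi(3)
    wfs_arr(2)[OF wfs' qj(1)] wfs_arr(1)[OF wfs' qj(2)] qj(3)
  have jp [simp]: "Dom C j = Cod C p"
    using gf by (simp add: pi(4) qj(4))
  have factor: "q \<cdot> p' \<in> Arr C" "i' \<cdot> i \<in> J" "Dom C (q \<cdot> p') = Cod C (i' \<cdot> i)" "g \<cdot> f = (q \<cdot> p') \<cdot> (i' \<cdot> i)"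
    if "p' \<in> Arr C" "i' \<in> J" "Dom C p' = Cod C i'" "Dom C i' = Dom C p" "Cod C p' = Cod C j"
      "p' \<cdot> i' = j \<cdot> p" for p' i'
  proof -
    note [simp] = that(1,3-5) wfs_arr(1)[OF wfs' that(2)]
    show "q \<cdot> p' \<in> Arr C" "Dom C (q \<cdot> p') = Cod C (i' \<cdot> i)" by simp_all
    show "i' \<cdot> i \<in> J" by (rule wfs_left_Comp[OF wfs' pi(2) that(2)]) simp
    show "g \<cdot> f = (q \<cdot> p') \<cdot> (i' \<cdot> i)"
      using Comp_cong_left[OF that(6), of i] by (simp add: pi(4) qj(4))
  qed
  {
    assume "f \<in> W"
    then have p: "p \<in> R"
      using W_right_factor pi by blast
    obtain i' p' where ip: "i' \<in> J" "p' \<in> R" "Dom C p' = Cod C i'" "Dom C i' = Dom C p"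
        "Cod C p' = Cod C j" "p' \<cdot> i' = j \<cdot> p"
      by (rule J_Comp_right[OF wfs p qj(2) jp])
    note fac = factor[OF wfs_arr(2)[OF wfs ip(2)] ip(1,3-6)]
    {
      assume "g \<in> W"
      then have "q \<in> R"
        using W_right_factor qj by blast
      then have "q \<cdot> p' \<in> R"
        by (rule wfs_right_Comp[OF wfs ip(2)]) (simp add: ip(5))
      then show "g \<cdot> f \<in> W"
        unfolding fac(4) by (rule W_I[OF _ fac(2,3)])
    next
      assume "g \<cdot> f \<in> W"
      moreover have "q \<cdot> p' \<in> F"
        by (rule wfs_right_Comp[OF wfs' _ qj(1)]) (use ip right_subset in auto)
      ultimately have "q \<cdot> p' \<in> R"
        unfolding fac(4) using W_right_factor fac(2,3) by blast
      then have "q \<in> R"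
        by (rule right_cancel[OF ip(2), rotated 2]) (simp_all add: ip(5))
      then show "g \<in> W"
        unfolding qj(4) using W_I qj by blast
    }
  next
    assume g: "g \<in> W" and gfW: "g \<cdot> f \<in> W"
    \<comment> \<open>Here \<open>p\<close> is only known to be in \<open>F\<close>, so the exchange
      is made in \<open>(J, F)\<close>; membership in \<open>R\<close> returns from
      \<open>p'\<close> to its retract \<open>p\<close>.\<close>
    obtain i' p' where ip: "i' \<in> J" "p' \<in> F" "Dom C p' = Cod C i'" "Dom C i' = Dom C p"
        "Cod C p' = Cod C j" "p' \<cdot> i' = j \<cdot> p" "retract_of C p p'"
      by (rule J_Comp_right[OF wfs' pi(1) qj(2) jp])
    note fac = factor[OF wfs_arr(2)[OF wfs' ip(2)] ip(1,3-6)]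
    have q: "q \<in> R"
      using g W_right_factor qj by blast
    have "q \<cdot> p' \<in> F"
      by (rule wfs_right_Comp[OF wfs' ip(2) qj(1)]) (simp add: ip(5))
    then have "q \<cdot> p' \<in> R"
      using gfW unfolding fac(4) using W_right_factor fac(2,3) by blast
    then have "p' \<in> R"
      by (rule right_cancel_left[OF q ip(2), rotated]) (simp add: ip(5))
    then have "p \<in> R"
      using wfs_retract(2)[OF wfs ip(7)] by simp
    then show "f \<in> W"
      unfolding pi(4) using W_I pi by blast
  }
qed

text \<open>Since \<open>R\<close> is \<open>F \<inter> W\<close> and \<open>J\<close> is
  \<open>L \<inter> W\<close>, the two weak factorization systems are exactly the lifting and
  factorization axioms. Fibrancy holds because zero maps lift every map into the zero
  object.\<close>

lemma fibrant_model_structure_Phi: "fibrant_model_structure C L F W"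
proof -
  have "to_zero C X \<in> F" if X: "X \<in> Ob C" for X
    unfolding mem_Collect_eq Hom_epic_iff
  proof (intro conjI ballI)
    note z = to_zero_Hom[OF X]
    note z' = z[unfolded Hom_iff]
    show "to_zero C X \<in> Arr C" using z' by simp
    fix T v assume T: "T \<in> U" and v: "v \<in> Hom C T (Cod C (to_zero C X))"
    have n: "Null C T X \<in> Hom C T (Dom C (to_zero C X))"
      using Hom_objects[OF v] X z' by (simp add: Hom_iff)
    have "to_zero C X \<cdot> Null C T X = v"
      by (rule to_zero_unique[of _ T]) (use n v z' in \<open>auto simp: Hom_iff\<close>)
    with n show "\<exists>h \<in> Hom C T (Dom C (to_zero C X)). to_zero C X \<cdot> h = v" by blast
  qed
  moreover have "lifts C f g" if "f \<in> L" "g \<in> F" "f \<in> W \<or> g \<in> W" for f g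
    using that F_Int_W L_Int_W wfs_lifts[OF wfs] wfs_lifts[OF wfs'] by blast
  ultimately show ?thesis
    unfolding fibrant_model_structure_def model_structure_def F_Int_W L_Int_W
    using wfs wfs' two_out_of_three_W retract_closed_W W_subset
    unfolding weak_factorization_system_def by blast
qed

end

section \<open>From fibrant model structures to fibrantly weak factorization systems\<close>

context wic_additive_category
begin

text \<open>The first conclusion makes \<open>Psi\<close> well defined; the other two say that
  \<open>Phi\<close> recovers the fibrations and weak equivalences.\<close>

lemma fibrant_model_structure_Psi:
  assumes "fibrant_model_structure C Cf Fb Wq"
  defines "U \<equiv> objects_from_zero_in C Cf \<inter> objects_to_zero_in C (Fb \<inter> Wq)"
  shows "fibrantly_weak_factorization_system C Cf (Fb \<inter> Wq)" (is ?fwfs)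
    and "Fb = {f. Hom_epic C U f}" (is ?Fb)
    and "Wq = composites C (Fb \<inter> Wq) (split_monos_with_cokernel_in C U)" (is ?Wq)
proof -
  let ?J = "split_monos_with_cokernel_in C U"
  have model: "model_structure C Cf Fb Wq" and fibrant: "\<And>X. X \<in> Ob C \<Longrightarrow> to_zero C X \<in> Fb"
    using assms(1) by (auto simp: fibrant_model_structure_def)
  have sub: "Cf \<subseteq> Arr C" "Fb \<subseteq> Arr C" "Wq \<subseteq> Arr C"
    and two: "two_out_of_three C Wq"
    and retr: "retract_closed C Cf" "retract_closed C Fb" "retract_closed C Wq"
    and lift: "\<And>f g. \<lbrakk>f \<in> Cf; g \<in> Fb; f \<in> Wq \<or> g \<in> Wq\<rbrakk> \<Longrightarrow> lifts C f g"
    and fact: "has_factorizations C (Cf \<inter> Wq) Fb" "has_factorizations C Cf (Fb \<inter> Wq)"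
    using model unfolding model_structure_def by blast+
  have wq_comp: "g \<cdot> f \<in> Wq" if "f \<in> Wq" "g \<in> Wq" "Dom C g = Cod C f" for f g
    using two that sub unfolding two_out_of_three_def by blast
  have wq_left: "g \<in> Wq" if "f \<in> Wq" "g \<in> Arr C" "Dom C g = Cod C f" "g \<cdot> f \<in> Wq" for f g
    using two that sub unfolding two_out_of_three_def by blast
  have wq_right: "f \<in> Wq" if "g \<in> Wq" "f \<in> Arr C" "Dom C g = Cod C f" "g \<cdot> f \<in> Wq" for f g
    using two that sub unfolding two_out_of_three_def by blast
  have retr': "retract_closed C (Cf \<inter> Wq)" "retract_closed C (Fb \<inter> Wq)"
    using retr unfolding retract_closed_def by blast+
  have wfs1: "weak_factorization_system C Cf (Fb \<inter> Wq)"
    unfolding weak_factorization_system_def using sub retr retr' lift fact by blast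
  have wfs2: "weak_factorization_system C (Cf \<inter> Wq) Fb"
    unfolding weak_factorization_system_def using sub retr retr' lift fact by blast
  have id_wq: "Ident C X \<in> Wq" if "X \<in> Ob C" for X
    using wfs_right_Ident[OF wfs1 that] by blast
  \<comment> \<open>The composite through \<open>X\<close> is the identity of the zero object, so
    two out of three applies.\<close>
  have zero_wq: "from_zero C X \<in> Wq \<longleftrightarrow> to_zero C X \<in> Wq" if X: "X \<in> Ob C" for X
  proof -
    note z = from_zero_Hom[OF X, unfolded Hom_iff] to_zero_Hom[OF X, unfolded Hom_iff]
    have "to_zero C X \<cdot> from_zero C X = Ident C (zero_object C)"
      by (rule from_zero_unique[of _ "zero_object C"]) (use z in \<open>auto simp: Hom_iff\<close>)
    then have "to_zero C X \<cdot> from_zero C X \<in> Wq"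
      using id_wq by simp
    then show ?thesis
      using wq_left[of "from_zero C X" "to_zero C X"] wq_right[of "to_zero C X" "from_zero C X"] z
      by auto
  qed
  \<comment> \<open>As every object is fibrant, \<open>U\<close> is also the class of objects
    cofibrant for the second system, which makes it projective relative to all of
    \<open>Fb\<close>.\<close>
  have U_eq: "U = objects_from_zero_in C (Cf \<inter> Wq)"
    unfolding U_def objects_from_zero_in_def objects_to_zero_in_def using zero_wq fibrant by blast
  have U_iff: "X \<in> U \<longleftrightarrow> X \<in> Ob C \<and>
      (\<forall>r \<in> Fb. \<forall>v \<in> Hom C X (Cod C r). \<exists>h \<in> Hom C X (Dom C r). r \<cdot> h = v)" for X
    unfolding U_eq by (rule objects_from_zero_iff[OF wfs2])
  have fb_epic: "Hom_epic C U g" if g: "g \<in> Fb" for g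
  proof -
    have "\<exists>h \<in> Hom C T (Dom C g). g \<cdot> h = v" if "T \<in> U" "v \<in> Hom C T (Cod C g)" for T v
      using that g unfolding U_iff by blast
    then show ?thesis
      unfolding Hom_epic_iff using g sub by blast
  qed
  have J: "?J = Cf \<inter> Wq"
  proof (intro equalityI subsetI)
    fix f assume f: "f \<in> ?J"
    then have "f \<in> Arr C"
      by (simp add: split_monos_with_cokernel_in_def split_mono_def)
    then show "f \<in> Cf \<inter> Wq"
      unfolding wfs_left_iff[OF wfs2, of f] using lifts_Hom_epic[OF f] fb_epic by blast
  next
    fix f assume f: "f \<in> Cf \<inter> Wq"
    define X E where "X = Dom C f" and "E = Cod C f"
    have [simp]: "f \<in> Arr C" "Dom C f = X" "Cod C f = E"
      using f sub by (auto simp: X_def E_def)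
    have [simp]: "X \<in> Ob C" "E \<in> Ob C"
      using Dom_closed[of f] Cod_closed[of f] by simp_all
    have "lifts C f (to_zero C X)"
      by (rule wfs_lifts[OF wfs2 f fibrant]) simp
    moreover have "Ident C X \<in> Hom C (Dom C f) X" by (simp add: Hom_iff)
    ultimately obtain r where r: "r \<in> Hom C (Cod C f) X" "r \<cdot> f = Ident C X"
      unfolding lifts_to_zero_iff[OF \<open>X \<in> Ob C\<close> \<open>f \<in> Arr C\<close>] by blast
    obtain K k c where b: "is_biproduct C X K E f k r c"
      using split_mono_biproduct[of f X E r] r by (auto simp: Hom_iff)
    note [simp] = biproduct_arr(4-15)[OF b] biproduct_eq[OF b] biproduct_Comp[OF b]
    \<comment> \<open>The cokernel of a trivial cofibration is trivially cofibrant: lift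
      \<open>v \<cdot> c\<close> with zero on \<open>X\<close> and restrict along
      \<open>k\<close>.\<close>
    have "\<exists>h \<in> Hom C K (Dom C g). g \<cdot> h = v" if g: "g \<in> Fb" and v: "v \<in> Hom C K (Cod C g)" for g v
    proof -
      have [simp]: "g \<in> Arr C" using g sub by blast
      have [simp]: "Dom C g \<in> Ob C" "Cod C g \<in> Ob C" by (simp_all add: Dom_closed Cod_closed)
      note [simp] = v[unfolded Hom_iff]
      obtain h where h: "h \<in> Hom C E (Dom C g)" "g \<cdot> h = v \<cdot> c"
        by (rule liftsE[OF wfs_lifts[OF wfs2 f g], of X E "Dom C g" "Cod C g" "Null C X (Dom C g)" "v \<cdot> c"])
           (simp_all add: Hom_iff)
      have "g \<cdot> (h \<cdot> k) = v"
        using Comp_cong_left[OF h(2), of k] h(1) by (simp add: Hom_iff)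
      then show ?thesis
        using h(1) by (intro bexI[of _ "h \<cdot> k"]) (auto simp: Hom_iff)
    qed
    then have "K \<in> U"
      unfolding U_iff by simp
    then show "f \<in> ?J"
      by (rule split_monos_with_cokernel_in_I[OF b])
  qed
  show Fb: ?Fb
  proof (intro equalityI subsetI)
    fix g assume "g \<in> {f. Hom_epic C U f}"
    then have g: "Hom_epic C U g" by simp
    then have "g \<in> Arr C" by (simp add: Hom_epic_def)
    then show "g \<in> Fb"
      unfolding wfs_right_iff[OF wfs2, of g] J[symmetric] using lifts_Hom_epic[OF _ g] by blast
  qed (use fb_epic in blast)
  show ?Wq
    unfolding J
  proof (intro equalityI subsetI)
    fix f assume f: "f \<in> Wq"
    then have f': "f \<in> Arr C" using sub by blast
    obtain i p where ip: "i \<in> Cf \<inter> Wq" "p \<in> Fb" "Dom C p = Cod C i" "f = p \<cdot> i"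
      using f' by (rule wfs_factor[OF wfs2])
    have "p \<in> Wq"
      using wq_left[of i p] ip f sub by blast
    with ip show "f \<in> composites C (Fb \<inter> Wq) (Cf \<inter> Wq)"
      unfolding composites_def by blast
  next
    fix f assume "f \<in> composites C (Fb \<inter> Wq) (Cf \<inter> Wq)"
    then show "f \<in> Wq"
      unfolding composites_def using wq_comp by blast
  qed
  \<comment> \<open>The approximation of \<open>B\<close> is the fibration in a factorization of the
    map from zero to \<open>B\<close>; the middle object is trivially cofibrant.\<close>
  have "contravariantly_finite C U"
    unfolding contravariantly_finite_def right_approximation_def
  proof (intro ballI)
    fix B assume B: "B \<in> Ob C"
    note z = from_zero_Hom[OF B, unfolded Hom_iff]
    obtain i p where ip: "i \<in> Cf \<inter> Wq" "p \<in> Fb" "Dom C p = Cod C i" "from_zero C B = p \<cdot> i"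
      by (rule wfs_factor[OF wfs2, of "from_zero C B"]) (use z in auto)
    define T where "T = Cod C i"
    have arr: "i \<in> Arr C" "p \<in> Arr C" using ip sub by auto
    have T: "T \<in> Ob C" using arr Cod_closed by (simp add: T_def)
    have "Dom C i = zero_object C" "Cod C p = B"
      using arr ip(3) z unfolding ip(4) by auto
    then have hom: "i \<in> Hom C (zero_object C) T" "p \<in> Hom C T B"
      using arr ip(3) by (auto simp: Hom_iff T_def)
    have "i = from_zero C T"
      by (rule from_zero_unique[OF hom(1) from_zero_Hom[OF T]])
    with ip(1) T have TU: "T \<in> U"
      by (simp add: U_eq objects_from_zero_in_def)
    have "\<exists>h \<in> Hom C T' T. s = p \<cdot> h" if "T' \<in> U" "s \<in> Hom C T' B" for T' s
    proof -
      have d: "Cod C p = B" "Dom C p = T"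
        using hom by (auto simp: Hom_iff)
      have "\<exists>h \<in> Hom C T' T. p \<cdot> h = s"
        using fb_epic[OF ip(2)] that unfolding Hom_epic_iff d by blast
      then show ?thesis by blast
    qed
    with TU hom(2) show "\<exists>t. \<exists>V \<in> U. t \<in> Hom C V B \<and>
        (\<forall>T' \<in> U. \<forall>s \<in> Hom C T' B. \<exists>h \<in> Hom C T' V. s = t \<cdot> h)" by blast
  qed
  \<comment> \<open>Cancellation: a lift through \<open>g \<cdot> f\<close> composed with
    \<open>f\<close> is a lift through \<open>g\<close>, so \<open>g\<close> is epic and hence in
    \<open>Fb\<close>; two out of three puts it in \<open>Wq\<close>.\<close>
  moreover have "g \<in> Fb \<inter> Wq"
    if f: "f \<in> Fb \<inter> Wq" and g: "g \<in> Arr C" and gf: "Dom C g = Cod C f" "g \<cdot> f \<in> Fb \<inter> Wq" for f g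
  proof -
    have f': "f \<in> Arr C" using f sub by blast
    have epic: "Hom_epic C U (g \<cdot> f)" using fb_epic gf by blast
    have "\<exists>h \<in> Hom C T (Dom C g). g \<cdot> h = v" if T: "T \<in> U" and v: "v \<in> Hom C T (Cod C g)" for T v
    proof -
      have "v \<in> Hom C T (Cod C (g \<cdot> f))" using v f' g gf(1) by simp
      then obtain h where h: "h \<in> Hom C T (Dom C (g \<cdot> f))" "(g \<cdot> f) \<cdot> h = v"
        using epic T unfolding Hom_epic_iff by blast
      then show ?thesis
        using f' g gf(1) by (intro bexI[of _ "f \<cdot> h"]) (auto simp: Hom_iff)
    qed
    then have "g \<in> Fb"
      unfolding Fb using g by (simp add: Hom_epic_iff)
    then show ?thesis
      using wq_left[of f g] f g gf by blast
  qed
  ultimately show ?fwfs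
    unfolding fibrantly_weak_factorization_system_def U_def[symmetric] using wfs1 by blast
qed

end

theorem theorem1p5:
  fixes C :: "('o, 'm, 'x) acat_scheme"
  assumes "wic_additive_category C"
  shows "Phi C ` Omega C \<subseteq> Gamma C \<and>
         Psi ` Gamma C \<subseteq> Omega C \<and>
         (\<forall>\<omega> \<in> Omega C. Psi (Phi C \<omega>) = \<omega>) \<and>
         (\<forall>\<gamma> \<in> Gamma C. Phi C (Psi \<gamma>) = \<gamma>)"
proof -
  interpret wic_additive_category C by (rule assms)
  have "Phi C (L, R) \<in> Gamma C \<and> Psi (Phi C (L, R)) = (L, R)"
    if "fibrantly_weak_factorization_system C L R" for L R
  proof -
    interpret fibrant_wfs C L R
      using that by unfold_locales
    show ?thesis
      using fibrant_model_structure_Phi F_Int_W by (simp add: Phi_def Psi_def Gamma_def Let_def)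
  qed
  moreover have "Psi (Cf, Fb, Wq) \<in> Omega C \<and> Phi C (Psi (Cf, Fb, Wq)) = (Cf, Fb, Wq)"
    if "fibrant_model_structure C Cf Fb Wq" for Cf Fb Wq
    using fibrant_model_structure_Psi[OF that] by (simp add: Phi_def Psi_def Omega_def Let_def)
  ultimately show ?thesis
    unfolding Omega_def Gamma_def by (auto simp: image_subset_iff)
qed

end
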